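(* Let $K$ be an infinite field of characteristic different from $2$ and $3$, let $(A,\omega)$ be an Artinian Bernstein algebra over $K$ with Peirce decomposition $A=Ke\oplus U\oplus V$ relative to a nonzero idempotent $e$, and let $N=U\oplus V=\ker(\omega)$. Then the following conditions are equivalent: (i) the ideal $N$ is nilpotent; (ii) the associative algebra $\mathcal{M}_*^N(V)$ is nilpotent; (iii) $I=0$ is the unique subspace $I$ of $A$ satisfying $VI=I$.
   Context: Algebras over $K$ are not assumed associative, unital or finite-dimensional. A baric algebra over $K$ is a pair $(A,\omega)$ where $A$ is a $K$-algebra and $\omega:A\to K$ is a nonzero homomorphism of $K$-algebras; its barideal is $N=\ker(\omega)$. A Bernstein algebra is a commutative baric algebra $(A,\omega)$ satisfying $(x^2)^2=\omega(x)^2x^2$ for all $x\in A$. Such an algebra has a nonzero idempotent $e$ (with $\omega(e)=1$), and then $A=Ke\oplus U\oplus V$ (Peirce decomposition), where $U=\{u\in A: eu=\tfrac12 u\}$, $V=\{v\in A: ev=0\}$ and $N=U\oplus V$. For subspaces $X,Y$ of $A$, $XY$ denotes the linear span of the products $xy$ with $x\in X$, $y\in Y$. For an algebra $B$, put $B^1=B$ and $B^i=\sum_{r+s=i,\ r,s\ge 1}B^rB^s$ for $i\ge 2$; $B$ is nilpotent if $B^n=0$ for some $n$. An algebra is Artinian if every descending sequence of its ideals is stationary. $\mathcal{M}_*^N(V)$ denotes the (not necessarily unital) associative subalgebra of $\mathrm{End}_K(N)$ generated by the multiplication operators $L_v:N\to N$, $L_v(x)=vx$, for $v\in V$. *)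

theory Defs
  imports
    Complex_Main
    "HOL-Library.Function_Algebras"
begin

text \<open>
  A \<open>K\<close>-algebra is a \<open>K\<close>-vector space on a whole type with a bilinear product; neither
  associativity nor a unit nor finite dimension is required.
\<close>

locale nonassoc_algebra = vector_space scale
  for scale :: "'k::field \<Rightarrow> 'a::ab_group_add \<Rightarrow> 'a" +
  fixes mult :: "'a \<Rightarrow> 'a \<Rightarrow> 'a"
  assumes linear_mult_left: "Vector_Spaces.linear scale scale (\<lambda>x. mult x y)"
    and linear_mult_right: "Vector_Spaces.linear scale scale (\<lambda>y. mult x y)"

locale baric_algebra = nonassoc_algebra scale mult
  for scale :: "'k::field \<Rightarrow> 'a::ab_group_add \<Rightarrow> 'a" and mult :: "'a \<Rightarrow> 'a \<Rightarrow> 'a" +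
  fixes \<omega> :: "'a \<Rightarrow> 'k"
  assumes weight_linear: "Vector_Spaces.linear scale (*) \<omega>"
    and weight_mult: "\<omega> (mult x y) = \<omega> x * \<omega> y"
    and weight_nonzero: "\<exists>x. \<omega> x \<noteq> 0"

locale bernstein_algebra = baric_algebra scale mult \<omega>
  for scale :: "'k::field \<Rightarrow> 'a::ab_group_add \<Rightarrow> 'a" and mult :: "'a \<Rightarrow> 'a \<Rightarrow> 'a"
    and \<omega> :: "'a \<Rightarrow> 'k" +
  assumes mult_commute: "mult x y = mult y x"
    and bernstein_identity: "mult (mult x x) (mult x x) = scale ((\<omega> x)\<^sup>2) (mult x x)"

definition barideal :: "('a \<Rightarrow> 'k::field) \<Rightarrow> 'a set"
  where "barideal \<omega> = {x. \<omega> x = 0}"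

definition peirce_half ::
    "('k::field \<Rightarrow> 'a::ab_group_add \<Rightarrow> 'a) \<Rightarrow> ('a \<Rightarrow> 'a \<Rightarrow> 'a) \<Rightarrow> 'a \<Rightarrow> 'a set"
  where "peirce_half scale mult e = {u. mult e u = scale (1 / 2) u}"

definition peirce_zero :: "('a::ab_group_add \<Rightarrow> 'a \<Rightarrow> 'a) \<Rightarrow> 'a \<Rightarrow> 'a set"
  where "peirce_zero mult e = {v. mult e v = 0}"

definition algebra_ideal ::
    "('k::field \<Rightarrow> 'a::ab_group_add \<Rightarrow> 'a) \<Rightarrow> ('a \<Rightarrow> 'a \<Rightarrow> 'a) \<Rightarrow> 'a set \<Rightarrow> bool"
  where "algebra_ideal scale mult J \<longleftrightarrow>
    module.subspace scale J \<and> (\<forall>a. \<forall>x\<in>J. mult a x \<in> J \<and> mult x a \<in> J)"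

definition artinian_algebra ::
    "('k::field \<Rightarrow> 'a::ab_group_add \<Rightarrow> 'a) \<Rightarrow> ('a \<Rightarrow> 'a \<Rightarrow> 'a) \<Rightarrow> bool"
  where "artinian_algebra scale mult \<longleftrightarrow>
    (\<forall>J :: nat \<Rightarrow> 'a set.
      (\<forall>n. algebra_ideal scale mult (J n)) \<longrightarrow> (\<forall>n. J (Suc n) \<subseteq> J n) \<longrightarrow>
      (\<exists>m. \<forall>n\<ge>m. J n = J m))"

definition prod_space ::
    "('k::field \<Rightarrow> 'a::ab_group_add \<Rightarrow> 'a) \<Rightarrow> ('a \<Rightarrow> 'a \<Rightarrow> 'a) \<Rightarrow> 'a set \<Rightarrow> 'a set \<Rightarrow> 'a set"
  where "prod_space scale mult X Y = module.span scale {mult x y |x y. x \<in> X \<and> y \<in> Y}"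

text \<open>
  The powers of an algebra \<open>B\<close>, given as a subspace closed under \<open>mult\<close>.  The sum of the
  subspaces \<open>B\<^sup>r B\<^sup>s\<close> is the span of their union.  Only exponents \<open>n \<ge> 1\<close> are
  meaningful.
\<close>

fun alg_power ::
    "('k::field \<Rightarrow> 'a::ab_group_add \<Rightarrow> 'a) \<Rightarrow> ('a \<Rightarrow> 'a \<Rightarrow> 'a) \<Rightarrow> 'a set \<Rightarrow> nat \<Rightarrow> 'a set"
  where "alg_power scale mult B n =
    (if n \<le> 1 then B
     else module.span scale
       (\<Union>r\<in>{1..<n}. prod_space scale mult (alg_power scale mult B r) (alg_power scale mult B (n - r))))"

declare alg_power.simps [simp del]

definition nilpotent_algebra ::
    "('k::field \<Rightarrow> 'a::ab_group_add \<Rightarrow> 'a) \<Rightarrow> ('a \<Rightarrow> 'a \<Rightarrow> 'a) \<Rightarrow> 'a set \<Rightarrow> bool"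
  where "nilpotent_algebra scale mult B \<longleftrightarrow> (\<exists>n\<ge>1. alg_power scale mult B n = {0})"

definition fun_scale :: "('k \<Rightarrow> 'a \<Rightarrow> 'a) \<Rightarrow> 'k \<Rightarrow> ('a \<Rightarrow> 'a) \<Rightarrow> 'a \<Rightarrow> 'a"
  where "fun_scale scale c f = (\<lambda>x. scale c (f x))"

text \<open>
  \<open>End\<^sub>K(N)\<close> for a subspace \<open>N\<close>: an endomorphism of \<open>N\<close> is represented by its extension by
  zero to the whole type, so the representation is unique and the operations of
  \<open>End\<^sub>K(N)\<close> are pointwise addition, pointwise scaling and composition of functions.
\<close>

definition endo :: "('k::field \<Rightarrow> 'a::ab_group_add \<Rightarrow> 'a) \<Rightarrow> 'a set \<Rightarrow> ('a \<Rightarrow> 'a) set"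
  where "endo scale N = {f.
    (\<forall>x\<in>N. f x \<in> N) \<and>
    (\<forall>x\<in>N. \<forall>y\<in>N. f (x + y) = f x + f y) \<and>
    (\<forall>c. \<forall>x\<in>N. f (scale c x) = scale c (f x)) \<and>
    (\<forall>x. x \<notin> N \<longrightarrow> f x = 0)}"

definition left_mult :: "('a::zero \<Rightarrow> 'a \<Rightarrow> 'a) \<Rightarrow> 'a set \<Rightarrow> 'a \<Rightarrow> 'a \<Rightarrow> 'a"
  where "left_mult mult N v = (\<lambda>x. if x \<in> N then mult v x else 0)"

definition endo_subalgebra ::
    "('k::field \<Rightarrow> 'a::ab_group_add \<Rightarrow> 'a) \<Rightarrow> 'a set \<Rightarrow> ('a \<Rightarrow> 'a) set \<Rightarrow> bool"
  where "endo_subalgebra scale N S \<longleftrightarrow>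
    S \<subseteq> endo scale N \<and> module.subspace (fun_scale scale) S \<and> (\<forall>f\<in>S. \<forall>g\<in>S. f \<circ> g \<in> S)"

definition mult_algebra ::
    "('k::field \<Rightarrow> 'a::ab_group_add \<Rightarrow> 'a) \<Rightarrow> ('a \<Rightarrow> 'a \<Rightarrow> 'a) \<Rightarrow> 'a set \<Rightarrow> 'a set \<Rightarrow> ('a \<Rightarrow> 'a) set"
  where "mult_algebra scale mult N V = endo_subalgebra scale N hull (left_mult mult N ` V)"

end

theory Submission
  imports Defs
begin

text \<open>
  The hard implication is from (iii) to (i). Write \<open>L\<^sub>v\<close> for multiplication by \<open>v\<close> and let \<open>Z\<close>
  be the set of \<open>z \<in> U\<close> with \<open>z U = 0\<close>. The linearized Bernstein identity gives \<open>U U \<subseteq> V\<close>, \<open>U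
  V \<subseteq> U\<close>, \<open>V V \<subseteq> Z\<close>, the cyclic identity \<open>(a b) c + (b c) a + (c a) b = 0\<close> on \<open>U\<close>, and two
  facts about \<open>v \<in> V\<close>: the operator \<open>L\<^sub>v\<close> is skew-adjoint for the product \<open>U \<times> U \<rightarrow> V\<close>, and
  modulo \<open>Z\<close> the operators \<open>L\<^sub>v\<close> anticommute and have square zero on \<open>U\<close>. The set \<open>Z\<close> is an
  ideal.

  The decisive point (lemma \<open>sixfold_product_zero\<close>) is that a word of at least seven operators
  \<open>L\<^sub>v\<close>, one of which has \<open>v \<in> U U\<close>, maps \<open>U\<close> into \<open>Z\<close>. A product of \<open>n\<close> skew-adjoint
  anticommuting operators is self-adjoint or skew-adjoint according to \<open>n mod 4\<close>. For three of
  them, self-adjointness and the cyclic identity give \<open>(x (\<lambda> z)) y = - \<lambda> ((x z) y)\<close> modulo \<open>Z\<close>;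
  applying this twice makes \<open>(x (\<lambda> \<mu> z)) y\<close> symmetric in \<open>x, z\<close>, whereas a product of six
  operators is skew-adjoint. Hence \<open>\<lambda> \<mu> ((x z) y)\<close> vanishes modulo \<open>Z\<close>.

  The Artinian condition enters twice. Every subspace between \<open>N N\<close> and \<open>N\<close> that is the sum of
  its intersections with \<open>U\<close> and \<open>V\<close> is an ideal, so \<open>N / N N\<close> has finite dimension (lemma
  \<open>artinian_finite_mod_square\<close>), and \<open>V\<close> is spanned by \<open>U U\<close> and finitely many further
  elements. Therefore long words in generators of \<open>V\<close> map \<open>U\<close> into \<open>Z\<close> (lemma
  \<open>long_act_in_Z\<close>). Secondly, the powers \<open>N, N N, N (N N), \<dots>\<close> become stationary at an ideal
  \<open>J\<close> with \<open>J = N J\<close>. An argument in the style of Engel's theorem, with finitely many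
  operators that anticommute up to smaller terms, shows \<open>J \<subseteq> Z\<close> (lemmas \<open>stable_subspace_in_Z\<close>
  and \<open>stable_ideal_zero\<close>). Then \<open>U J = 0\<close>, so \<open>J = V J\<close>, and (iii) yields \<open>J = 0\<close>.

  The remaining implications are formal: an element of the \<open>k\<close>-th power of the multiplication
  algebra maps \<open>N\<^sup>r\<close> into the power with exponent \<open>r + k\<close>, and \<open>V I = I\<close> makes \<open>I\<close> the span of
  the images of arbitrarily long words in the \<open>L\<^sub>v\<close>.
\<close>

section \<open>Bilinear products and words of left multiplications\<close>

context nonassoc_algebra
begin

notation scale (infixr "*s" 75)
notation mult (infixl "\<odot>" 70)

lemma mult_add_left: "(x + y) \<odot> z = x \<odot> z + y \<odot> z"
  and mult_scale_left: "(c *s x) \<odot> z = c *s (x \<odot> z)"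
  using linear_mult_left[of z] by (simp_all add: Vector_Spaces.linear_iff)

lemma mult_add_right: "z \<odot> (x + y) = z \<odot> x + z \<odot> y"
  and mult_scale_right: "z \<odot> (c *s x) = c *s (z \<odot> x)"
  using linear_mult_right[of z] by (simp_all add: Vector_Spaces.linear_iff)

lemma mult_zero_left [simp]: "0 \<odot> x = 0" and mult_zero_right [simp]: "x \<odot> 0 = 0"
  using mult_scale_left[of 0 0 x] mult_scale_right[of x 0 0] by auto

lemma mult_minus_left: "(- x) \<odot> y = - (x \<odot> y)" and mult_minus_right: "x \<odot> (- y) = - (x \<odot> y)"
  using mult_scale_left[of "-1" x y] mult_scale_right[of x "-1" y] by auto

lemma mult_diff_left: "(x - y) \<odot> z = x \<odot> z - y \<odot> z"
  and mult_diff_right: "z \<odot> (x - y) = z \<odot> x - z \<odot> y"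
  by (simp_all add: diff_conv_add_uminus mult_add_left mult_add_right mult_minus_left
      mult_minus_right del: add_uminus_conv_diff)

lemmas mult_expand = mult_add_left mult_add_right mult_minus_left mult_minus_right
  mult_diff_left mult_diff_right mult_scale_left mult_scale_right

lemmas scale_expand = scale_right_distrib scale_right_diff_distrib scale_left_distrib

lemma linear_image_span:
  assumes "x \<in> span X" "\<And>x. x \<in> X \<Longrightarrow> f x \<in> Y" "subspace Y"
    and add: "\<And>x y. f (x + y) = f x + f y" and sc: "\<And>c x. f (c *s x) = c *s f x"
  shows "f x \<in> Y"
  using assms(1)
proof (rule span_induct)
  have "f 0 = 0" using sc[of 0 0] by simp
  then show "subspace {x. f x \<in> Y}"
    using \<open>subspace Y\<close> by (simp add: subspace_def add sc)
qed (use assms in auto)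

abbreviation act :: "'a list \<Rightarrow> 'a \<Rightarrow> 'a" where "act vs x \<equiv> foldr (\<odot>) vs x"

lemma act_add: "act vs (x + y) = act vs x + act vs y"
  and act_scale: "act vs (c *s x) = c *s act vs x"
  by (induction vs) (simp_all add: mult_expand)

lemma act_closed:
  assumes "\<And>b x. b \<in> C \<Longrightarrow> x \<in> M \<Longrightarrow> b \<odot> x \<in> M" "set bs \<subseteq> C" "x \<in> M"
  shows "act bs x \<in> M"
  using assms(2) by (induction bs) (use assms in auto)

text \<open>
  By the pigeonhole principle a word longer than \<open>card B\<close> repeats a letter. Up to errors in
  \<open>Y\<close> the letters anticommute, so the two occurrences can be moved next to each other, and
  there they contribute a square.
\<close>
lemma anticommuting_act:
  assumes B: "finite B" and Y: "subspace Y"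
    and M: "\<And>b x. b \<in> B \<Longrightarrow> x \<in> M \<Longrightarrow> b \<odot> x \<in> M"
    and BY: "\<And>b y. b \<in> B \<Longrightarrow> y \<in> Y \<Longrightarrow> b \<odot> y \<in> Y"
    and anti: "\<And>b c x. b \<in> B \<Longrightarrow> c \<in> B \<Longrightarrow> x \<in> M \<Longrightarrow> b \<odot> (c \<odot> x) + c \<odot> (b \<odot> x) \<in> Y"
    and sq: "\<And>b x. b \<in> B \<Longrightarrow> x \<in> M \<Longrightarrow> b \<odot> (b \<odot> x) \<in> Y"
    and bs: "set bs \<subseteq> B" "card B < length bs" and x: "x \<in> M"
  shows "act bs x \<in> Y"
proof -
  have "\<not> distinct bs"
    using bs B by (metis card_mono distinct_card leD)
  then obtain xs ys zs b where bs_eq: "bs = xs @ [b] @ ys @ [b] @ zs"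
    using not_distinct_decomp by blast
  have bB: "b \<in> B" and ys: "set ys \<subseteq> B" and xs: "set xs \<subseteq> B" and zs: "set zs \<subseteq> B"
    using bs(1) by (auto simp: bs_eq)
  have x': "act zs x \<in> M" using act_closed[of B M, OF M zs x] .
  have "b \<odot> act ys (b \<odot> act zs x) \<in> Y"
    using ys
  proof (induction ys)
    case Nil
    then show ?case using sq[OF bB x'] by simp
  next
    case (Cons c ys)
    then have c: "c \<in> B" and ys: "set ys \<subseteq> B" by auto
    let ?y = "act ys (b \<odot> act zs x)"
    have "?y \<in> M" by (rule act_closed[of B M, OF M ys]) (use M bB x' in auto)
    then have "b \<odot> (c \<odot> ?y) + c \<odot> (b \<odot> ?y) \<in> Y" by (rule anti[OF bB c])
    moreover have "c \<odot> (b \<odot> ?y) \<in> Y" using Cons.IH[OF ys] BY[OF c] by blast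
    ultimately have "(b \<odot> (c \<odot> ?y) + c \<odot> (b \<odot> ?y)) - c \<odot> (b \<odot> ?y) \<in> Y"
      by (rule subspace_diff[OF Y])
    then show ?case by simp
  qed
  then have "act xs (b \<odot> act ys (b \<odot> act zs x)) \<in> Y"
    using act_closed[of B Y, OF BY xs] by blast
  then show ?thesis by (simp add: bs_eq)
qed

text \<open>
  If \<open>G\<close> is contained in \<open>Y + C G\<close>, then substituting this inclusion into itself \<open>n\<close> times
  expresses \<open>G\<close> through words of length \<open>n\<close>. Only letters from the generating set \<open>C\<close> occur,
  so that no multilinear expansion of words is needed later.
\<close>
lemma subset_span_act:
  assumes G: "G \<subseteq> span (Y \<union> {c \<odot> g |c g. c \<in> C \<and> g \<in> G})"
    and Y: "subspace Y" and CY: "\<And>c y. c \<in> C \<Longrightarrow> y \<in> Y \<Longrightarrow> c \<odot> y \<in> Y"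
  shows "G \<subseteq> span (Y \<union> {act cs g |cs g. set cs \<subseteq> C \<and> length cs = n \<and> g \<in> G})"
proof (induction n)
  case 0
  show ?case by (auto intro!: span_base)
next
  case (Suc n)
  let ?W = "\<lambda>n. {act cs g |cs g. set cs \<subseteq> C \<and> length cs = n \<and> g \<in> G}"
  have step: "c \<odot> g \<in> span (Y \<union> ?W (Suc n))" if c: "c \<in> C" and g: "g \<in> G" for c g
  proof -
    have "g \<in> span (Y \<union> ?W n)" using Suc g by blast
    then show ?thesis
    proof (rule linear_image_span)
      fix x assume "x \<in> Y \<union> ?W n"
      then show "c \<odot> x \<in> span (Y \<union> ?W (Suc n))"
      proof
        assume "x \<in> ?W n"
        then obtain cs g where "x = act cs g" "set cs \<subseteq> C" "length cs = n" "g \<in> G" by blast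
        then have "c \<odot> x = act (c # cs) g" "set (c # cs) \<subseteq> C" "length (c # cs) = Suc n"
          using c by auto
        then have "c \<odot> x \<in> ?W (Suc n)" using \<open>g \<in> G\<close> by blast
        then show ?thesis by (simp add: span_base)
      qed (use CY c in \<open>simp add: span_base\<close>)
    qed (simp_all add: mult_expand)
  qed
  have "Y \<union> {c \<odot> g |c g. c \<in> C \<and> g \<in> G} \<subseteq> span (Y \<union> ?W (Suc n))"
    using step by (auto simp: span_base)
  then show ?case using G span_minimal[OF _ subspace_span] by blast
qed

end

section \<open>Peirce decomposition of a Bernstein algebra\<close>

locale bernstein_idempotent = bernstein_algebra scale mult \<omega>
  for scale :: "'k::field \<Rightarrow> 'a::ab_group_add \<Rightarrow> 'a" and mult and \<omega> +
  fixes e :: 'a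
  assumes two: "(2::'k) \<noteq> 0" and three: "(3::'k) \<noteq> 0"
    and e_nonzero: "e \<noteq> 0" and idempotent: "mult e e = e"
begin

abbreviation U where "U \<equiv> peirce_half scale mult e"
abbreviation V where "V \<equiv> peirce_zero mult e"
abbreviation N where "N \<equiv> barideal \<omega>"

lemma weight_add: "\<omega> (x + y) = \<omega> x + \<omega> y" and weight_scale: "\<omega> (c *s x) = c * \<omega> x"
  using weight_linear by (simp_all add: Vector_Spaces.linear_iff)

lemma weight_minus: "\<omega> (- x) = - \<omega> x"
  using weight_scale[of "-1" x] by simp

lemma weight_e: "\<omega> e = 1"
proof -
  have "e = scale ((\<omega> e)\<^sup>2) e"
    using bernstein_identity[of e] by (simp add: idempotent)
  moreover have "(\<omega> e)\<^sup>2 = \<omega> e"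
    using weight_mult[of e e] by (simp add: idempotent power2_eq_square)
  ultimately show ?thesis
    using e_nonzero by (cases "\<omega> e = 0") (auto simp: power2_eq_square)
qed

lemma double_eq_0: "x + x = 0 \<Longrightarrow> x = (0::'a)"
proof -
  assume "x + x = 0"
  then have "2 *s x = 0"
    using scale_left_distrib[of 1 1 x] by simp
  then show ?thesis using two by simp
qed

lemma sum_diff_eq_0: "p + q = 0 \<Longrightarrow> p - q = 0 \<Longrightarrow> p + p = (0::'a)"
proof -
  assume "p + q = 0" "p - q = 0"
  moreover have "p + p = (p + q) + (p - q)" by simp
  ultimately show ?thesis by simp
qed

lemma subspace_half: "subspace S \<Longrightarrow> x + x \<in> S \<Longrightarrow> x \<in> S"
proof -
  assume S: "subspace S" "x + x \<in> S"
  have "(1/2) *s (x + x) = x"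
    using two scale_left_distrib[of "1/2" "1/2" x] by (simp add: scale_right_distrib)
  then show "x \<in> S" using subspace_scale[OF S, of "1/2"] by simp
qed

lemma U_iff: "u \<in> U \<longleftrightarrow> e \<odot> u + e \<odot> u = u"
proof -
  have "e \<odot> u = (1/2) *s u \<longleftrightarrow> 2 *s (e \<odot> u) = u"
  proof
    assume "2 *s (e \<odot> u) = u"
    then have "(1/2) *s (2 *s (e \<odot> u)) = (1/2) *s u" by simp
    then show "e \<odot> u = (1/2) *s u" using two by simp
  qed (use two in simp)
  then show ?thesis
    using scale_left_distrib[of 1 1 "e \<odot> u"] by (simp add: peirce_half_def)
qed

lemma V_iff: "v \<in> V \<longleftrightarrow> e \<odot> v = 0"
  by (simp add: peirce_zero_def)

lemma N_iff: "x \<in> N \<longleftrightarrow> \<omega> x = 0"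
  by (simp add: barideal_def)

lemma subspace_U: "subspace U"
  by (auto simp: subspace_def U_iff mult_expand scale_expand[symmetric] algebra_simps)

lemma subspace_V: "subspace V"
  by (simp add: subspace_def V_iff mult_expand)

lemma subspace_N: "subspace N"
  using weight_scale[of 0 0] by (simp add: subspace_def N_iff weight_add weight_scale)

lemma U_subset_N: "u \<in> U \<Longrightarrow> u \<in> N"
proof -
  assume "u \<in> U"
  then have "\<omega> u = \<omega> (e \<odot> u) + \<omega> (e \<odot> u)" by (metis U_iff weight_add)
  then have "\<omega> u = \<omega> u + \<omega> u" by (simp only: weight_mult weight_e mult_1)
  then show "u \<in> N" by (metis N_iff add_cancel_right_right)
qed

lemma V_subset_N: "v \<in> V \<Longrightarrow> v \<in> N"
  using weight_mult[of e v] weight_scale[of 0 0]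
  by (simp add: N_iff peirce_zero_def weight_e)

lemma U_Int_V: "x \<in> U \<Longrightarrow> x \<in> V \<Longrightarrow> x = 0"
  by (simp add: U_iff V_iff)

lemma N_mult: "x \<in> N \<Longrightarrow> a \<odot> x \<in> N"
  by (simp add: N_iff weight_mult)

text \<open>
  Expand \<open>(x\<^sup>2)\<^sup>2 = \<omega>(x)\<^sup>2 x\<^sup>2\<close> at \<open>x + t y\<close>. Since \<open>\<omega> y = 0\<close>, the weight does not depend on
  \<open>t\<close>, and the coefficients of \<open>t\<^sup>0\<close> and \<open>t\<^sup>4\<close> cancel by the identity for \<open>x\<close> and for \<open>y\<close>. The
  three remaining coefficients vanish because their system at \<open>t = 1, -1, 2\<close> is invertible
  when \<open>2\<close> and \<open>3\<close> are. The condition on \<open>c\<close> covers the weights \<open>0\<close> and \<open>1\<close> at once.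
\<close>
lemma bernstein_linearized:
  assumes y: "\<omega> y = 0" and x: "\<omega> x = c" and c: "c * c = c"
  shows "4 *s ((x \<odot> x) \<odot> (x \<odot> y)) = (2 * c) *s (x \<odot> y)"
    and "4 *s ((x \<odot> y) \<odot> (x \<odot> y)) + 2 *s ((x \<odot> x) \<odot> (y \<odot> y)) = c *s (y \<odot> y)"
proof -
  define p q r where "p = x \<odot> x" and "q = x \<odot> y" and "r = y \<odot> y"
  define D1 where "D1 = 4 *s (p \<odot> q) - (2 * c) *s q"
  define D2 where "D2 = 4 *s (q \<odot> q) + 2 *s (p \<odot> r) - c *s r"
  define D3 where "D3 = 4 *s (q \<odot> r)"
  have c2: "c\<^sup>2 = c" using c by (simp add: power2_eq_square)
  have pp: "p \<odot> p = c *s p" and rr: "r \<odot> r = 0"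
    using bernstein_identity[of x] bernstein_identity[of y] by (simp_all add: p_def r_def x y c2)
  have qp: "q \<odot> p = p \<odot> q" "r \<odot> p = p \<odot> r" "r \<odot> q = q \<odot> r" by (simp_all add: mult_commute)
  \<comment> \<open>The values \<open>D1\<close>, \<open>D2\<close>, \<open>D3\<close> are the coefficients of \<open>t\<close>, \<open>t\<^sup>2\<close>, \<open>t\<^sup>3\<close>.\<close>
  have key: "t *s D1 + (t * t) *s D2 + (t * t * t) *s D3 = 0" for t
  proof -
    define z where "z = x + t *s y"
    have "\<omega> z = c" by (simp add: z_def weight_add weight_scale x y)
    then have b: "(z \<odot> z) \<odot> (z \<odot> z) = c *s (z \<odot> z)"
      using bernstein_identity[of z] by (simp add: c2)
    have "z \<odot> z = p + (2 * t) *s q + (t * t) *s r"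
      using mult_commute[of y x] scale_left_distrib[of t t q]
      by (simp add: z_def p_def q_def r_def mult_expand scale_expand algebra_simps)
    then have "(p + (2 * t) *s q + (t * t) *s r) \<odot> (p + (2 * t) *s q + (t * t) *s r)
       = c *s (p + (2 * t) *s q + (t * t) *s r)"
      using b by simp
    then have "(2 * t) *s (p \<odot> q) + (2 * t) *s (p \<odot> q) + (4 * t * t) *s (q \<odot> q)
        + ((t * t) *s (p \<odot> r) + (t * t) *s (p \<odot> r))
        + ((2 * t * t * t) *s (q \<odot> r) + (2 * t * t * t) *s (q \<odot> r))
       = (2 * t * c) *s q + (t * t * c) *s r"
      by (simp add: mult_expand scale_expand pp rr qp algebra_simps)
    then have "(4 * t) *s (p \<odot> q) + (4 * t * t) *s (q \<odot> q)
        + (2 * t * t) *s (p \<odot> r) + (4 * t * t * t) *s (q \<odot> r)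
       = (2 * t * c) *s q + (t * t * c) *s r"
      unfolding scale_left_distrib[symmetric] by (simp add: algebra_simps)
    then show ?thesis
      by (simp add: D1_def D2_def D3_def scale_expand algebra_simps)
  qed
  have k1: "D1 + D2 + D3 = 0" using key[of 1] by simp
  have k2: "- D1 + D2 - D3 = 0" using key[of "-1"] by simp
  have k3: "2 *s D1 + 4 *s D2 + 8 *s D3 = 0" using key[of 2] by simp
  have "D2 + D2 = (D1 + D2 + D3) + (- D1 + D2 - D3)" by simp
  then have "D2 + D2 = 0" unfolding k1 k2 by simp
  then have D2: "D2 = 0" by (rule double_eq_0)
  have D1: "D1 = - D3" using k1 D2 by (simp add: eq_neg_iff_add_eq_0)
  have "(8 - 2) *s D3 = 0" using k3 unfolding D1 D2 scale_left_diff_distrib by simp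
  moreover have "(8 - 2 :: 'k) \<noteq> 0"
  proof -
    have "(8 - 2 :: 'k) = 2 * 3" by simp
    then show ?thesis using two three by (metis mult_eq_0_iff)
  qed
  ultimately have "D3 = 0" by (metis scale_eq_0_iff)
  then have "D1 = 0" using D1 by simp
  then show "4 *s ((x \<odot> x) \<odot> (x \<odot> y)) = (2 * c) *s (x \<odot> y)"
    by (simp add: D1_def p_def q_def)
  show "4 *s ((x \<odot> y) \<odot> (x \<odot> y)) + 2 *s ((x \<odot> x) \<odot> (y \<odot> y)) = c *s (y \<odot> y)"
    using D2 by (simp add: D2_def p_def q_def r_def)
qed

lemma scale_two: "2 *s x = x + x"
  using scale_left_distrib[of 1 1 x] by simp

lemma scale_four: "4 *s x = (x + x) + (x + x)"
  using scale_left_distrib[of 2 2 x] by (simp add: scale_two)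

lemma bernstein_weight_1:
  assumes "\<omega> x = 1" "\<omega> y = 0"
  shows "(x \<odot> x) \<odot> (x \<odot> y) + (x \<odot> x) \<odot> (x \<odot> y) = x \<odot> y"
proof -
  have "2 *s (((x \<odot> x) \<odot> (x \<odot> y) + (x \<odot> x) \<odot> (x \<odot> y)) - x \<odot> y) = 0"
    using bernstein_linearized(1)[OF assms(2) assms(1)] by (simp add: scale_two scale_four algebra_simps)
  then show ?thesis using two by simp
qed

lemma bernstein_e:
  assumes "y \<in> N"
  shows "4 *s ((e \<odot> y) \<odot> (e \<odot> y)) + 2 *s (e \<odot> (y \<odot> y)) = y \<odot> y"
  using bernstein_linearized(2)[OF _ weight_e, of y] assms by (simp add: N_iff idempotent)

lemma U_square_in_V: "u \<in> U \<Longrightarrow> u \<odot> u \<in> V"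
proof -
  assume u: "u \<in> U"
  then have "(e \<odot> u + e \<odot> u) \<odot> (e \<odot> u + e \<odot> u) = u \<odot> u" by (simp add: U_iff)
  then have "4 *s ((e \<odot> u) \<odot> (e \<odot> u)) = u \<odot> u"
    by (simp add: mult_expand scale_four algebra_simps)
  then have "2 *s (e \<odot> (u \<odot> u)) = 0" using bernstein_e[OF U_subset_N[OF u]] by simp
  then show ?thesis using two by (simp add: V_iff)
qed

lemma UU_in_V: assumes "u \<in> U" "u' \<in> U" shows "u \<odot> u' \<in> V"
proof -
  have "(u + u') \<odot> (u + u') - u \<odot> u - u' \<odot> u' \<in> V"
    using assms by (intro subspace_diff U_square_in_V subspace_V) (auto intro: subspace_add subspace_U)
  then have "u \<odot> u' + u \<odot> u' \<in> V"
    using mult_commute[of u' u] by (simp add: mult_expand algebra_simps)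
  then show ?thesis by (rule subspace_half[OF subspace_V])
qed

lemma V_square_in_U: "v \<in> V \<Longrightarrow> v \<odot> v \<in> U"
  using bernstein_e[OF V_subset_N, of v] by (simp add: V_iff U_iff scale_two)

lemma VV_in_U: assumes "v \<in> V" "v' \<in> V" shows "v \<odot> v' \<in> U"
proof -
  have "(v + v') \<odot> (v + v') - v \<odot> v - v' \<odot> v' \<in> U"
    using assms by (intro subspace_diff V_square_in_U subspace_U) (auto intro: subspace_add subspace_V)
  then have "v \<odot> v' + v \<odot> v' \<in> U"
    using mult_commute[of v' v] by (simp add: mult_expand algebra_simps)
  then show ?thesis by (rule subspace_half[OF subspace_U])
qed

lemma VU_in_U: assumes "v \<in> V" "u \<in> U" shows "v \<odot> u \<in> U"
proof -
  have ev: "e \<odot> v = 0" using assms by (simp add: V_iff)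
  have E: "4 *s ((e \<odot> u) \<odot> (e \<odot> u)) + 2 *s (e \<odot> (u \<odot> u)) = u \<odot> u"
    "2 *s (e \<odot> (v \<odot> v)) = v \<odot> v"
    using bernstein_e[of u] bernstein_e[of v] assms by (auto simp: U_subset_N V_subset_N ev)
  have "4 *s ((e \<odot> (u + v)) \<odot> (e \<odot> (u + v))) + 2 *s (e \<odot> ((u + v) \<odot> (u + v)))
      = (u + v) \<odot> (u + v)"
    using assms by (intro bernstein_e subspace_add[OF subspace_N]) (auto simp: U_subset_N V_subset_N)
  moreover have "4 *s ((e \<odot> (u + v)) \<odot> (e \<odot> (u + v))) + 2 *s (e \<odot> ((u + v) \<odot> (u + v)))
      = (4 *s ((e \<odot> u) \<odot> (e \<odot> u)) + 2 *s (e \<odot> (u \<odot> u))) + 2 *s (e \<odot> (v \<odot> v))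
        + 2 *s (e \<odot> (v \<odot> u + v \<odot> u))"
    using mult_commute[of u v] by (simp add: mult_expand ev scale_right_distrib algebra_simps)
  moreover have "(u + v) \<odot> (u + v) = u \<odot> u + v \<odot> v + (v \<odot> u + v \<odot> u)"
    using mult_commute[of u v] by (simp add: mult_expand algebra_simps)
  ultimately have "2 *s (e \<odot> (v \<odot> u + v \<odot> u)) = v \<odot> u + v \<odot> u"
    using E by simp
  then have "v \<odot> u + v \<odot> u \<in> U" by (simp add: U_iff scale_two)
  then show ?thesis by (rule subspace_half[OF subspace_U])
qed

lemma UV_in_U: "u \<in> U \<Longrightarrow> v \<in> V \<Longrightarrow> u \<odot> v \<in> U"
  using VU_in_U mult_commute by metis

lemma peirce_direct: "v \<in> V \<Longrightarrow> u \<in> U \<Longrightarrow> v + u = 0 \<Longrightarrow> v = 0 \<and> u = 0"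
proof -
  assume v: "v \<in> V" and u: "u \<in> U" and z: "v + u = 0"
  have "v = - u" using z by (simp add: eq_neg_iff_add_eq_0)
  then have "v \<in> U" using u by (simp add: subspace_neg subspace_U)
  then have "v = 0" using v U_Int_V by blast
  then show ?thesis using z by simp
qed

text \<open>
  Multiplication by \<open>2 e\<close> is the projection of \<open>N = U + V\<close> onto \<open>U\<close>.
\<close>
definition upart :: "'a \<Rightarrow> 'a" where "upart x = e \<odot> x + e \<odot> x"

lemma upart_add: "upart (x + y) = upart x + upart y"
  and upart_scale: "upart (c *s x) = c *s upart x"
  by (simp_all add: upart_def mult_expand scale_expand algebra_simps)

lemma upart_U [simp]: "u \<in> U \<Longrightarrow> upart u = u" and upart_V [simp]: "v \<in> V \<Longrightarrow> upart v = 0"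
  by (simp_all add: upart_def U_iff V_iff)

lemma upart_in_U: "x \<in> N \<Longrightarrow> upart x \<in> U"
  using bernstein_weight_1[OF weight_e, of x]
  by (simp add: U_iff upart_def N_iff idempotent mult_expand)

lemma vpart_in_V: "x \<in> N \<Longrightarrow> x - upart x \<in> V"
  using bernstein_weight_1[OF weight_e, of x]
  by (simp add: V_iff upart_def N_iff idempotent mult_expand)

lemma e_mult_U: "u \<in> U \<Longrightarrow> e \<odot> u = (1/2) *s u"
  by (simp add: peirce_half_def)

lemma bernstein_at_e_plus_u:
  assumes u: "u \<in> U" and y: "y \<in> N"
  shows "(e + (u + u \<odot> u)) \<odot> (e \<odot> y + u \<odot> y) + (e + (u + u \<odot> u)) \<odot> (e \<odot> y + u \<odot> y)
    = e \<odot> y + u \<odot> y"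
proof -
  have "\<omega> (e + u) = 1" using u U_subset_N by (simp add: weight_add weight_e N_iff)
  moreover have "(e + u) \<odot> (e + u) = e + (u + u \<odot> u)"
    using u mult_commute[of u e] by (simp add: mult_expand idempotent U_iff algebra_simps)
  ultimately show ?thesis
    using bernstein_weight_1[of "e + u" y] y by (simp add: N_iff mult_add_left)
qed

text \<open>
  The identity at \<open>e + u\<close> in the direction \<open>w\<close> is a sum of a part of degree two and a part of
  degree three in \<open>u\<close>; replacing \<open>u\<close> by \<open>- u\<close> separates them.
\<close>
lemma UUU_sq:
  assumes u: "u \<in> U" and w: "w \<in> U"
  shows "(u \<odot> w) \<odot> u + (u \<odot> w) \<odot> u + (u \<odot> u) \<odot> w = 0"
proof -
  have h: "e \<odot> w + e \<odot> w = w" using w by (simp add: U_iff)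
  have R: "(u \<odot> w) \<odot> u + (u \<odot> w) \<odot> u + (u \<odot> u) \<odot> w
      + ((u \<odot> u) \<odot> (u \<odot> w) + (u \<odot> u) \<odot> (u \<odot> w)) = 0" if u: "u \<in> U" for u
  proof -
    have uw: "e \<odot> (u \<odot> w) = 0" using UU_in_V[OF u w] by (simp add: V_iff)
    have hw: "x \<odot> (e \<odot> w) + x \<odot> (e \<odot> w) = x \<odot> w" for x
      using h by (metis mult_add_right)
    have "(e + (u + u \<odot> u)) \<odot> (e \<odot> w) + (e + (u + u \<odot> u)) \<odot> (e \<odot> w)
        + ((e + (u + u \<odot> u)) \<odot> (u \<odot> w) + (e + (u + u \<odot> u)) \<odot> (u \<odot> w)) = e \<odot> w + u \<odot> w"
      using bernstein_at_e_plus_u[OF u U_subset_N[OF w]] by (simp add: mult_add_right algebra_simps)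
    then have "(e + (u + u \<odot> u)) \<odot> w + ((e + (u + u \<odot> u)) \<odot> (u \<odot> w) + (e + (u + u \<odot> u)) \<odot> (u \<odot> w))
       = e \<odot> w + u \<odot> w"
      unfolding hw .
    then show ?thesis
      by (simp add: mult_add_left uw mult_commute[of "u \<odot> w" u] algebra_simps)
  qed
  have "(u \<odot> w) \<odot> u + (u \<odot> w) \<odot> u + (u \<odot> u) \<odot> w
      - ((u \<odot> u) \<odot> (u \<odot> w) + (u \<odot> u) \<odot> (u \<odot> w)) = 0"
    using R[OF subspace_neg[OF subspace_U u]] by (simp add: mult_expand algebra_simps)
  from R[OF u] this have "((u \<odot> w) \<odot> u + (u \<odot> w) \<odot> u + (u \<odot> u) \<odot> w)
     + ((u \<odot> w) \<odot> u + (u \<odot> w) \<odot> u + (u \<odot> u) \<odot> w) = 0"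
    by (rule sum_diff_eq_0)
  then show ?thesis by (rule double_eq_0)
qed

lemma UUU_cyclic:
  assumes "a \<in> U" "b \<in> U" "c \<in> U"
  shows "(a \<odot> b) \<odot> c + (b \<odot> c) \<odot> a + (c \<odot> a) \<odot> b = 0"
proof -
  have "((a + c) \<odot> b) \<odot> (a + c) + ((a + c) \<odot> b) \<odot> (a + c) + ((a + c) \<odot> (a + c)) \<odot> b = 0"
    using assms by (intro UUU_sq) (auto intro: subspace_add subspace_U)
  moreover have "((a \<odot> b) \<odot> a + (a \<odot> b) \<odot> a + (a \<odot> a) \<odot> b) = 0" "((c \<odot> b) \<odot> c + (c \<odot> b) \<odot> c + (c \<odot> c) \<odot> b) = 0"
    using assms by (auto intro: UUU_sq)
  moreover have "((a + c) \<odot> b) \<odot> (a + c) + ((a + c) \<odot> b) \<odot> (a + c) + ((a + c) \<odot> (a + c)) \<odot> b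
    = ((a \<odot> b) \<odot> a + (a \<odot> b) \<odot> a + (a \<odot> a) \<odot> b) + ((c \<odot> b) \<odot> c + (c \<odot> b) \<odot> c + (c \<odot> c) \<odot> b)
     + (((a \<odot> b) \<odot> c + (b \<odot> c) \<odot> a + (c \<odot> a) \<odot> b) + ((a \<odot> b) \<odot> c + (b \<odot> c) \<odot> a + (c \<odot> a) \<odot> b))"
    by (simp add: mult_expand mult_commute[of c b] mult_commute[of a c])
  ultimately have "((a \<odot> b) \<odot> c + (b \<odot> c) \<odot> a + (c \<odot> a) \<odot> b) + ((a \<odot> b) \<odot> c + (b \<odot> c) \<odot> a + (c \<odot> a) \<odot> b) = 0"
    by simp
  then show ?thesis by (rule double_eq_0)
qed

text \<open>
  The identity at \<open>e + u\<close> in the direction \<open>v\<close> is a sum of a term in \<open>V\<close> and a term in \<open>U\<close>,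
  which vanish separately.
\<close>
lemma UUV_sq:
  assumes u: "u \<in> U" and v: "v \<in> V"
  shows "u \<odot> (v \<odot> u) = 0"
proof -
  have "u \<odot> v \<in> U" using u v by (rule UV_in_U)
  then have euv: "e \<odot> (u \<odot> v) + e \<odot> (u \<odot> v) = u \<odot> v" by (simp add: U_iff)
  have "(e + (u + u \<odot> u)) \<odot> (u \<odot> v) + (e + (u + u \<odot> u)) \<odot> (u \<odot> v) = u \<odot> v"
    using bernstein_at_e_plus_u[OF u V_subset_N[OF v]] v by (simp add: V_iff)
  then have "(e \<odot> (u \<odot> v) + e \<odot> (u \<odot> v)) + (u \<odot> (u \<odot> v) + u \<odot> (u \<odot> v)
      + ((u \<odot> u) \<odot> (u \<odot> v) + (u \<odot> u) \<odot> (u \<odot> v))) = u \<odot> v"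
    by (simp add: mult_add_left algebra_simps)
  then have "(u \<odot> (u \<odot> v) + u \<odot> (u \<odot> v)) + ((u \<odot> u) \<odot> (u \<odot> v) + (u \<odot> u) \<odot> (u \<odot> v)) = 0"
    unfolding euv by simp
  moreover have "u \<odot> (u \<odot> v) + u \<odot> (u \<odot> v) \<in> V"
    using u \<open>u \<odot> v \<in> U\<close> by (simp add: subspace_add subspace_V UU_in_V)
  moreover have "(u \<odot> u) \<odot> (u \<odot> v) + (u \<odot> u) \<odot> (u \<odot> v) \<in> U"
    using u \<open>u \<odot> v \<in> U\<close> by (simp add: subspace_add subspace_U UU_in_V VU_in_U)
  ultimately have "u \<odot> (u \<odot> v) + u \<odot> (u \<odot> v) = 0" using peirce_direct by blast
  then show ?thesis using double_eq_0 mult_commute by metis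
qed

text \<open>
  Polarization shows that \<open>L\<^sub>v\<close> is skew-adjoint for the symmetric bilinear product \<open>U \<times> U \<rightarrow>
  V\<close>.
\<close>
lemma UUV_skew:
  assumes "a \<in> U" "b \<in> U" "v \<in> V"
  shows "a \<odot> (v \<odot> b) = - (b \<odot> (v \<odot> a))"
proof -
  have "(a + b) \<odot> (v \<odot> (a + b)) = 0" "a \<odot> (v \<odot> a) = 0" "b \<odot> (v \<odot> b) = 0"
    using assms by (auto intro!: UUV_sq subspace_add[OF subspace_U])
  then show ?thesis by (simp add: mult_expand eq_neg_iff_add_eq_0 algebra_simps)
qed

text \<open>
  The identity at \<open>e + v\<close> in the direction \<open>u\<close> has a part of degree two and a part of degree
  three in \<open>v\<close>; replacing \<open>v\<close> by \<open>- v\<close> separates them.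
\<close>
lemma VV_mult_U_sq:
  assumes u: "u \<in> U" and v: "v \<in> V"
  shows "(v \<odot> v) \<odot> u = 0"
proof -
  have R: "(v \<odot> v) \<odot> u + ((v \<odot> v) \<odot> (v \<odot> u) + (v \<odot> v) \<odot> (v \<odot> u)) = 0" if v: "v \<in> V" for v
  proof -
    have hu: "x \<odot> (e \<odot> u) + x \<odot> (e \<odot> u) = x \<odot> u" for x
      using u by (metis mult_add_right U_iff)
    have euv: "e \<odot> (v \<odot> u) + e \<odot> (v \<odot> u) = v \<odot> u" using VU_in_U[OF v u] by (simp add: U_iff)
    have w: "\<omega> (e + v) = 1" using v V_subset_N by (simp add: weight_add weight_e N_iff)
    have sq: "(e + v) \<odot> (e + v) = e + v \<odot> v"
      using v mult_commute[of v e] by (simp add: mult_expand idempotent V_iff)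
    have "(e + v \<odot> v) \<odot> ((e + v) \<odot> u) + (e + v \<odot> v) \<odot> ((e + v) \<odot> u) = (e + v) \<odot> u"
      using bernstein_weight_1[OF w, of u] U_subset_N[OF u] by (simp add: N_iff sq)
    then have "(e \<odot> (e \<odot> u) + e \<odot> (e \<odot> u)) + (e \<odot> (v \<odot> u) + e \<odot> (v \<odot> u))
      + ((v \<odot> v) \<odot> (e \<odot> u) + (v \<odot> v) \<odot> (e \<odot> u)) + ((v \<odot> v) \<odot> (v \<odot> u) + (v \<odot> v) \<odot> (v \<odot> u))
       = e \<odot> u + v \<odot> u"
      by (simp add: mult_expand algebra_simps)
    then show ?thesis unfolding hu euv by (simp add: algebra_simps)
  qed
  have "(v \<odot> v) \<odot> u - ((v \<odot> v) \<odot> (v \<odot> u) + (v \<odot> v) \<odot> (v \<odot> u)) = 0"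
    using R[OF subspace_neg[OF subspace_V v]] by (simp add: mult_expand algebra_simps)
  from R[OF v] this have "(v \<odot> v) \<odot> u + (v \<odot> v) \<odot> u = 0"
    by (rule sum_diff_eq_0)
  then show ?thesis by (rule double_eq_0)
qed

lemma VV_mult_U:
  assumes "u \<in> U" "v \<in> V" "w \<in> V"
  shows "(v \<odot> w) \<odot> u = 0"
proof -
  have "((v + w) \<odot> (v + w)) \<odot> u = 0" "(v \<odot> v) \<odot> u = 0" "(w \<odot> w) \<odot> u = 0"
    using assms by (auto intro!: VV_mult_U_sq subspace_add[OF subspace_V])
  then have "(v \<odot> w) \<odot> u + (v \<odot> w) \<odot> u = 0"
    by (simp add: mult_expand mult_commute[of w v] algebra_simps)
  then show ?thesis by (rule double_eq_0)
qed

text \<open>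
  The linearized identity for two elements of weight zero reads \<open>4 (v u)\<^sup>2 + 2 v\<^sup>2 u\<^sup>2 = 0\<close>;
  here the first term lies in \<open>V\<close> and the second in \<open>U\<close>.
\<close>
lemma VU_sq:
  assumes u: "u \<in> U" and v: "v \<in> V"
  shows "(v \<odot> u) \<odot> (v \<odot> u) = 0"
proof -
  define a b where "a = (u \<odot> v) \<odot> (u \<odot> v)" and "b = (u \<odot> u) \<odot> (v \<odot> v)"
  have "4 *s a + 2 *s b = 0"
    using bernstein_linearized(2)[of v u 0] u v U_subset_N V_subset_N by (simp add: N_iff a_def b_def)
  moreover have "a \<in> V" unfolding a_def using u v by (intro UU_in_V UV_in_U)
  moreover have "b \<in> U" unfolding b_def using u v by (intro VU_in_U UU_in_V VV_in_U)
  ultimately have "4 *s a = 0"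
    using peirce_direct[of "4 *s a" "2 *s b"] by (simp add: subspace_scale subspace_U subspace_V)
  then have "a = 0" using double_eq_0 by (metis scale_four)
  then show ?thesis by (simp add: a_def mult_commute)
qed

lemma VU_VU_skew:
  assumes a: "a \<in> U" and b: "b \<in> U" and v: "v \<in> V" and w: "w \<in> V"
  shows "(v \<odot> a) \<odot> (w \<odot> b) = - ((w \<odot> a) \<odot> (v \<odot> b))"
proof -
  have R: "(v \<odot> a) \<odot> (v \<odot> b) = 0" if v: "v \<in> V" for v
  proof -
    have "(v \<odot> (a + b)) \<odot> (v \<odot> (a + b)) = 0" "(v \<odot> a) \<odot> (v \<odot> a) = 0" "(v \<odot> b) \<odot> (v \<odot> b) = 0"
      using a b v by (auto intro!: VU_sq subspace_add[OF subspace_U])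
    then have "(v \<odot> a) \<odot> (v \<odot> b) + (v \<odot> a) \<odot> (v \<odot> b) = 0"
      by (simp add: mult_expand mult_commute[of "v \<odot> b" "v \<odot> a"] algebra_simps)
    then show ?thesis by (rule double_eq_0)
  qed
  have "((v + w) \<odot> a) \<odot> ((v + w) \<odot> b) = 0" using v w by (intro R subspace_add[OF subspace_V])
  then show ?thesis using R[OF v] R[OF w] by (simp add: mult_expand eq_neg_iff_add_eq_0 algebra_simps)
qed


section \<open>Multiplications by elements of V, modulo the annihilator of U\<close>

text \<open>
  This set is an ideal of the algebra; modulo it \<open>V V\<close> vanishes and the operators \<open>L\<^sub>v\<close> on \<open>U\<close>
  generate an image of an exterior algebra.
\<close>

definition Z where "Z = {z \<in> U. \<forall>u \<in> U. z \<odot> u = 0}"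

lemma subspace_Z: "subspace Z"
  using subspace_U by (simp add: subspace_def Z_def mult_expand)

lemma Z_subset_U: "z \<in> Z \<Longrightarrow> z \<in> U"
  by (simp add: Z_def)

lemma U_mult_Z: "z \<in> Z \<Longrightarrow> u \<in> U \<Longrightarrow> u \<odot> z = 0"
  by (simp add: Z_def mult_commute[of u])

lemma V_mult_Z:
  assumes v: "v \<in> V" and z: "z \<in> Z"
  shows "v \<odot> z \<in> Z"
proof -
  have "(v \<odot> z) \<odot> u = 0" if u: "u \<in> U" for u
  proof -
    have "(v \<odot> z) \<odot> u = u \<odot> (v \<odot> z)" by (rule mult_commute)
    also have "\<dots> = - (z \<odot> (v \<odot> u))" by (rule UUV_skew[OF u Z_subset_U[OF z] v])
    also have "z \<odot> (v \<odot> u) = 0" using z VU_in_U[OF v u] by (simp add: Z_def)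
    finally show ?thesis by simp
  qed
  then show ?thesis
    using VU_in_U[OF v Z_subset_U[OF z]] by (simp add: Z_def)
qed

lemma VV_in_Z: "v \<in> V \<Longrightarrow> w \<in> V \<Longrightarrow> v \<odot> w \<in> Z"
  by (simp add: Z_def VV_in_U VV_mult_U)

text \<open>
  By skew-adjointness the product of this sum with \<open>x \<in> U\<close> is a sum of two products of the
  form \<open>(v u) (w x)\<close>, which cancel by \<open>VU_VU_skew\<close>.
\<close>
lemma V_anticommute: "v \<in> V \<Longrightarrow> w \<in> V \<Longrightarrow> u \<in> U \<Longrightarrow> v \<odot> (w \<odot> u) + w \<odot> (v \<odot> u) \<in> Z"
proof -
  assume v: "v \<in> V" and w: "w \<in> V" and u: "u \<in> U"
  have "(v \<odot> (w \<odot> u) + w \<odot> (v \<odot> u)) \<odot> x = 0" if x: "x \<in> U" for x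
  proof -
    have "x \<odot> (v \<odot> (w \<odot> u)) = - ((w \<odot> u) \<odot> (v \<odot> x))"
      "x \<odot> (w \<odot> (v \<odot> u)) = - ((v \<odot> u) \<odot> (w \<odot> x))"
      using UUV_skew x u v w VU_in_U by blast+
    then have "x \<odot> (v \<odot> (w \<odot> u)) + x \<odot> (w \<odot> (v \<odot> u)) = 0"
      using VU_VU_skew[OF u x v w] by simp
    then show ?thesis by (simp add: mult_add_right mult_commute[of _ x])
  qed
  then show ?thesis
    using v w u by (auto simp: Z_def intro!: subspace_add subspace_U VU_in_U)
qed

lemma V_square: "v \<in> V \<Longrightarrow> u \<in> U \<Longrightarrow> v \<odot> (v \<odot> u) \<in> Z"
  using V_anticommute[of v v u] subspace_half[OF subspace_Z] by blast

definition zeq :: "'a \<Rightarrow> 'a \<Rightarrow> bool" (infix "\<approx>" 50) where "x \<approx> y \<longleftrightarrow> x - y \<in> Z"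

lemma zeq_refl [simp]: "x \<approx> x"
  by (simp add: zeq_def subspace_0 subspace_Z)

lemma zeq_sym: "x \<approx> y \<Longrightarrow> y \<approx> x"
  using subspace_neg[OF subspace_Z, of "x - y"] by (simp add: zeq_def)

lemma zeq_trans [trans]: "x \<approx> y \<Longrightarrow> y \<approx> z \<Longrightarrow> x \<approx> z"
  using subspace_add[OF subspace_Z, of "x - y" "y - z"] by (simp add: zeq_def)

lemma zeq_add: "x \<approx> y \<Longrightarrow> x' \<approx> y' \<Longrightarrow> x + x' \<approx> y + y'"
  using subspace_add[OF subspace_Z, of "x - y" "x' - y'"] by (simp add: zeq_def algebra_simps)

lemma zeq_minus: "x \<approx> y \<Longrightarrow> - x \<approx> - y"
  using subspace_neg[OF subspace_Z, of "x - y"] by (simp add: zeq_def)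

lemma zeq_mult: "v \<in> V \<Longrightarrow> x \<approx> y \<Longrightarrow> v \<odot> x \<approx> v \<odot> y"
  using V_mult_Z[of v "x - y"] by (simp add: zeq_def mult_expand)

lemma zeq_mult_U: "u \<in> U \<Longrightarrow> x \<approx> y \<Longrightarrow> u \<odot> x = u \<odot> y"
  using U_mult_Z[of "x - y" u] by (simp add: zeq_def mult_expand)

lemma zeq_Z: "x \<approx> y \<Longrightarrow> y \<in> Z \<Longrightarrow> x \<in> Z"
  using subspace_add[OF subspace_Z, of "x - y" y] by (simp add: zeq_def)

lemma V_swap: "v \<in> V \<Longrightarrow> w \<in> V \<Longrightarrow> u \<in> U \<Longrightarrow> v \<odot> (w \<odot> u) \<approx> - (w \<odot> (v \<odot> u))"
  using V_anticommute[of v w u] by (simp add: zeq_def)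

lemma V_swap3:
  assumes "w \<in> V" "a \<in> V" "b \<in> V" "c \<in> V" "u \<in> U"
  shows "w \<odot> (a \<odot> (b \<odot> (c \<odot> u))) \<approx> - (a \<odot> (b \<odot> (c \<odot> (w \<odot> u))))"
proof -
  have "w \<odot> (a \<odot> (b \<odot> (c \<odot> u))) \<approx> - (a \<odot> (w \<odot> (b \<odot> (c \<odot> u))))"
    using assms by (intro V_swap VU_in_U)
  also have "\<dots> \<approx> - (a \<odot> (- (b \<odot> (w \<odot> (c \<odot> u)))))"
    using assms by (intro zeq_minus zeq_mult V_swap VU_in_U)
  also have "\<dots> \<approx> - (a \<odot> (- (b \<odot> (- (c \<odot> (w \<odot> u))))))"
    using assms by (intro zeq_minus zeq_mult V_swap VU_in_U)
  finally show ?thesis by (simp add: mult_expand)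
qed

text \<open>
  Taking adjoints of \<open>L\<^sub>a L\<^sub>b L\<^sub>c\<close> gives the sign \<open>(-1)\<^sup>3\<close> and reverses the order; restoring
  the order of three anticommuting operators is an odd permutation. The signs cancel, so the
  product is self-adjoint.
\<close>
lemma form_swap3:
  assumes "x \<in> U" "y \<in> U" "a \<in> V" "b \<in> V" "c \<in> V"
  shows "x \<odot> (a \<odot> (b \<odot> (c \<odot> y))) = y \<odot> (a \<odot> (b \<odot> (c \<odot> x)))"
proof -
  have "x \<odot> (a \<odot> (b \<odot> (c \<odot> y))) = - (b \<odot> (c \<odot> y) \<odot> (a \<odot> x))"
    using assms by (intro UUV_skew VU_in_U)
  also have "\<dots> = - ((a \<odot> x) \<odot> (b \<odot> (c \<odot> y)))" by (simp add: mult_commute)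
  also have "\<dots> = (c \<odot> y) \<odot> (b \<odot> (a \<odot> x))"
    using assms UUV_skew[of "a \<odot> x" "c \<odot> y" b] by (simp add: VU_in_U)
  also have "\<dots> = (b \<odot> (a \<odot> x)) \<odot> (c \<odot> y)" by (rule mult_commute)
  also have "\<dots> = - (y \<odot> (c \<odot> (b \<odot> (a \<odot> x))))"
    using assms by (intro UUV_skew VU_in_U)
  also have "y \<odot> (c \<odot> (b \<odot> (a \<odot> x))) = y \<odot> (- (b \<odot> (c \<odot> (a \<odot> x))))"
    using assms by (intro zeq_mult_U V_swap VU_in_U)
  also have "y \<odot> (- (b \<odot> (c \<odot> (a \<odot> x)))) = y \<odot> (- (b \<odot> (- (a \<odot> (c \<odot> x)))))"
    using assms by (intro zeq_mult_U zeq_minus zeq_mult V_swap VU_in_U)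
  also have "\<dots> = y \<odot> (b \<odot> (a \<odot> (c \<odot> x)))" by (simp add: mult_expand)
  also have "\<dots> = y \<odot> (- (a \<odot> (b \<odot> (c \<odot> x))))"
    using assms by (intro zeq_mult_U V_swap VU_in_U)
  finally show ?thesis by (simp add: mult_expand)
qed

text \<open>
  With \<open>\<lambda> = L\<^sub>a L\<^sub>b L\<^sub>c\<close>, the expression \<open>h x z y = (x (\<lambda> z)) y\<close> is symmetric in \<open>x\<close> and \<open>z\<close>.
  The cyclic identity for \<open>x, \<lambda> z, y\<close> determines \<open>h x z y + h y z x\<close>; three instances of this
  relation can be solved for \<open>h x z y\<close>.
\<close>
lemma slide3:
  assumes U: "x \<in> U" "y \<in> U" "z \<in> U" and V: "a \<in> V" "b \<in> V" "c \<in> V"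
  shows "(x \<odot> (a \<odot> (b \<odot> (c \<odot> z)))) \<odot> y \<approx> - (a \<odot> (b \<odot> (c \<odot> ((x \<odot> z) \<odot> y))))"
proof -
  define l where "l t = a \<odot> (b \<odot> (c \<odot> t))" for t
  have lU: "l t \<in> U" if "t \<in> U" for t using that V by (simp add: l_def VU_in_U)
  have l_add: "l (s + t) = l s + l t" for s t by (simp add: l_def mult_expand)
  define h where "h x z y = (x \<odot> l z) \<odot> y" for x z y
  have h_sym: "h x z y = h z x y" if "x \<in> U" "z \<in> U" for x z y
    using form_swap3[OF that V] by (simp add: h_def l_def)
  \<comment> \<open>The cyclic identity, with \<open>\<lambda>\<close> moved past \<open>y x \<in> V\<close> at the cost of the sign \<open>(-1)\<^sup>3\<close>.\<close>
  have h_sum: "h x z y + h y z x \<approx> l ((y \<odot> x) \<odot> z)" if "x \<in> U" "y \<in> U" "z \<in> U" for x y z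
  proof -
    have "(x \<odot> l z) \<odot> y + (l z \<odot> y) \<odot> x + (y \<odot> x) \<odot> l z = 0"
      using that lU by (intro UUU_cyclic)
    then have "h x z y + h y z x = - ((y \<odot> x) \<odot> l z)"
      by (simp add: h_def mult_commute[of "l z" y] eq_neg_iff_add_eq_0)
    moreover have "- ((y \<odot> x) \<odot> l z) \<approx> - (- l ((y \<odot> x) \<odot> z))"
      unfolding l_def using that V by (intro zeq_minus V_swap3 UU_in_V)
    ultimately show ?thesis by simp
  qed
  let ?L = "l ((x \<odot> z) \<odot> y)"
  \<comment> \<open>The two unwanted values of \<open>h\<close> cancel by symmetry, and the right-hand side is evaluated by the cyclic identity.\<close>
  have "(h x z y + h y z x) + (h z x y + h y x z) + - (h x y z + h z y x)
      \<approx> l ((y \<odot> x) \<odot> z) + l ((y \<odot> z) \<odot> x) + - l ((z \<odot> x) \<odot> y)"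
    using U by (intro zeq_add zeq_minus h_sum)
  moreover have "(h x z y + h y z x) + (h z x y + h y x z) + - (h x y z + h z y x) = h x z y + h x z y"
    using h_sym[of z x y] h_sym[of y x z] h_sym[of y z x] U by simp
  moreover have "l ((y \<odot> x) \<odot> z) + l ((y \<odot> z) \<odot> x) + - l ((z \<odot> x) \<odot> y) = - ?L - ?L"
  proof -
    have "l ((x \<odot> y) \<odot> z + (y \<odot> z) \<odot> x + (z \<odot> x) \<odot> y) = 0"
      using UUU_cyclic[OF U] by (simp add: l_def)
    then have "l ((y \<odot> x) \<odot> z) + l ((y \<odot> z) \<odot> x) + ?L = 0"
      by (simp add: l_add mult_commute[of y x] mult_commute[of z x])
    then show ?thesis
      by (simp add: mult_commute[of z x] algebra_simps eq_neg_iff_add_eq_0)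
  qed
  ultimately have "h x z y + h x z y \<approx> - ?L - ?L" by (simp only:)
  then have "(h x z y + ?L) + (h x z y + ?L) \<in> Z"
    by (simp add: zeq_def algebra_simps)
  then have "h x z y + ?L \<in> Z" by (rule subspace_half[OF subspace_Z])
  then show ?thesis by (simp add: zeq_def h_def l_def)
qed

text \<open>
  With \<open>\<lambda> = L\<^sub>a L\<^sub>b L\<^sub>c\<close> and \<open>\<mu>\<close> its primed analogue, \<open>slide3\<close> used twice gives \<open>(x (\<lambda> \<mu> z)) y
  = \<lambda> \<mu> ((x z) y)\<close> modulo \<open>Z\<close>, which is symmetric in \<open>x\<close> and \<open>z\<close>. Taking adjoints of the
  self-adjoint \<open>\<lambda>\<close> and \<open>\<mu>\<close> turns \<open>\<lambda> \<mu>\<close> into \<open>\<mu> \<lambda>\<close>, and this is \<open>- \<lambda> \<mu>\<close> because nine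
  anticommutations are needed. So the left-hand side is also skew in \<open>x\<close> and \<open>z\<close>.
\<close>
lemma sixfold_product_zero:
  assumes U: "x \<in> U" "y \<in> U" "z \<in> U"
    and V: "a \<in> V" "b \<in> V" "c \<in> V" "a' \<in> V" "b' \<in> V" "c' \<in> V"
  shows "a \<odot> (b \<odot> (c \<odot> (a' \<odot> (b' \<odot> (c' \<odot> ((x \<odot> z) \<odot> y)))))) \<in> Z"
proof -
  define l m where "l t = a \<odot> (b \<odot> (c \<odot> t))" and "m t = a' \<odot> (b' \<odot> (c' \<odot> t))" for t
  have lU: "l t \<in> U" and mU: "m t \<in> U" if "t \<in> U" for t
    using that V by (simp_all add: l_def m_def VU_in_U)
  have l_zeq: "l s \<approx> l t" if "s \<approx> t" for s t
    unfolding l_def using that V by (intro zeq_mult)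
  have l_minus: "l (- t) = - l t" for t by (simp add: l_def mult_expand)
  have slide: "(x \<odot> l (m z)) \<odot> y \<approx> l (m ((x \<odot> z) \<odot> y))" if "x \<in> U" "z \<in> U" for x z
  proof -
    have "(x \<odot> l (m z)) \<odot> y \<approx> - l ((x \<odot> m z) \<odot> y)"
      unfolding l_def using that U V mU by (intro slide3)
    also have "\<dots> \<approx> - l (- m ((x \<odot> z) \<odot> y))"
      unfolding m_def using that U V by (intro zeq_minus l_zeq slide3)
    finally show ?thesis by (simp add: l_minus)
  qed
  have skew: "x \<odot> l (m z) = - (z \<odot> l (m x))"
  proof -
    have "x \<odot> l (m z) = m z \<odot> l x"
      unfolding l_def using U V mU by (intro form_swap3)
    also have "\<dots> = l x \<odot> m z" by (rule mult_commute)
    also have "\<dots> = z \<odot> m (l x)"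
      unfolding m_def using U V lU by (intro form_swap3)
    also have "\<dots> = z \<odot> (a' \<odot> (b' \<odot> (- l (c' \<odot> x))))"
      unfolding m_def l_def using U V by (intro zeq_mult_U zeq_mult V_swap3)
    also have "\<dots> = z \<odot> (- (a' \<odot> (b' \<odot> l (c' \<odot> x))))" by (simp add: mult_expand)
    also have "\<dots> = z \<odot> (- (a' \<odot> (- l (b' \<odot> (c' \<odot> x)))))"
      unfolding l_def using U V by (intro zeq_mult_U zeq_minus zeq_mult V_swap3 VU_in_U)
    also have "\<dots> = z \<odot> (a' \<odot> l (b' \<odot> (c' \<odot> x)))" by (simp add: mult_expand)
    also have "\<dots> = z \<odot> (- l (a' \<odot> (b' \<odot> (c' \<odot> x))))"
      unfolding l_def using U V by (intro zeq_mult_U V_swap3 VU_in_U)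
    finally show ?thesis by (simp add: mult_expand m_def)
  qed
  let ?w = "l (m ((x \<odot> z) \<odot> y))"
  have "(x \<odot> l (m z)) \<odot> y + (z \<odot> l (m x)) \<odot> y \<approx> ?w + l (m ((z \<odot> x) \<odot> y))"
    using U by (intro zeq_add slide)
  moreover have "(x \<odot> l (m z)) \<odot> y + (z \<odot> l (m x)) \<odot> y = 0"
    by (simp add: skew mult_minus_left)
  ultimately have "0 \<approx> ?w + ?w" by (simp add: mult_commute[of z x])
  then have "?w + ?w \<in> Z"
    using zeq_sym zeq_Z subspace_0[OF subspace_Z] by blast
  then have "?w \<in> Z" by (rule subspace_half[OF subspace_Z])
  then show ?thesis by (simp add: l_def m_def)
qed

lemma act_in_U: "set vs \<subseteq> V \<Longrightarrow> u \<in> U \<Longrightarrow> act vs u \<in> U"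
  using act_closed[of V U] VU_in_U by blast

lemma act_in_Z: "set vs \<subseteq> V \<Longrightarrow> z \<in> Z \<Longrightarrow> act vs z \<in> Z"
  using act_closed[of V Z] V_mult_Z by blast

text \<open>
  The scalar is a sign depending on the length of the word; only its existence matters below.
\<close>
lemma act_swap:
  assumes "v \<in> V" "set vs \<subseteq> V" "u \<in> U"
  shows "\<exists>s. v \<odot> act vs u \<approx> s *s act vs (v \<odot> u)"
  using assms(2)
proof (induction vs)
  case Nil
  have "v \<odot> act [] u \<approx> 1 *s act [] (v \<odot> u)" by simp
  then show ?case by blast
next
  case (Cons w vs)
  then have w: "w \<in> V" and vs: "set vs \<subseteq> V" by auto
  obtain s where s: "v \<odot> act vs u \<approx> s *s act vs (v \<odot> u)" using Cons.IH[OF vs] by blast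
  have "v \<odot> (w \<odot> act vs u) \<approx> - (w \<odot> (v \<odot> act vs u))"
    using assms(1,3) w vs by (intro V_swap act_in_U)
  also have "\<dots> \<approx> - (w \<odot> (s *s act vs (v \<odot> u)))"
    by (intro zeq_minus zeq_mult w s)
  also have "\<dots> = (- s) *s act (w # vs) (v \<odot> u)" by (simp add: mult_scale_right)
  finally have "v \<odot> act (w # vs) u \<approx> (- s) *s act (w # vs) (v \<odot> u)" by simp
  then show ?case by blast
qed

text \<open>
  The factor in \<open>U U\<close> is moved to the innermost place, where the six letters applied after it
  map into \<open>Z\<close>.
\<close>
lemma long_act_with_UU_factor:
  assumes vs: "set vs \<subseteq> V" "6 < length vs" and w: "x \<odot> z \<in> set vs"
    and U: "x \<in> U" "z \<in> U" "u \<in> U"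
  shows "act vs u \<in> Z"
proof -
  obtain as bs where vs_eq: "vs = as @ (x \<odot> z) # bs" using w by (metis split_list)
  then have as: "set as \<subseteq> V" and bs: "set bs \<subseteq> V" and len: "6 \<le> length (as @ bs)" using vs by auto
  let ?t = "(x \<odot> z) \<odot> u"
  define cs where "cs = take (length (as @ bs) - 6) (as @ bs)"
  define ds where "ds = drop (length (as @ bs) - 6) (as @ bs)"
  have cd: "as @ bs = cs @ ds" by (simp only: cs_def ds_def append_take_drop_id)
  have "length ds = 6" using len by (simp add: ds_def)
  then obtain a b c a' b' c' where ds: "ds = [a, b, c, a', b', c']"
    by (auto simp: numeral_eq_Suc length_Suc_conv)
  have "set cs \<union> set ds = set as \<union> set bs" using cd by (metis set_append)
  then have cs: "set cs \<subseteq> V" and "set ds \<subseteq> V" using as bs by auto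
  then have "act ds ?t \<in> Z" using sixfold_product_zero[OF U(1,3,2)] by (simp add: ds)
  then have "act (as @ bs) ?t \<in> Z" using act_in_Z[OF cs] by (simp add: cd)
  then have "act as (act bs ?t) \<in> Z" by simp
  moreover obtain s where s: "(x \<odot> z) \<odot> act bs u \<approx> s *s act bs ?t"
    using act_swap[OF UU_in_V[OF U(1,2)] bs U(3)] by blast
  moreover have "act as ((x \<odot> z) \<odot> act bs u) =
      act as ((x \<odot> z) \<odot> act bs u - s *s act bs ?t) + s *s act as (act bs ?t)"
    by (simp only: act_add[symmetric] act_scale[symmetric] diff_add_cancel)
  moreover have "act as ((x \<odot> z) \<odot> act bs u - s *s act bs ?t) \<in> Z"
    using s act_in_Z[OF as] by (simp add: zeq_def)
  ultimately have "act as ((x \<odot> z) \<odot> act bs u) \<in> Z"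
    by (simp add: subspace_add[OF subspace_Z] subspace_scale[OF subspace_Z])
  then show ?thesis by (simp add: vs_eq)
qed

text \<open>
  A word either has a letter in \<open>U U\<close>, or it is a word in the finitely many letters of \<open>F\<close> and
  \<open>anticommuting_act\<close> applies. The two cases need more than \<open>6\<close> and more than \<open>card F\<close>
  letters.
\<close>
lemma long_act_in_Z:
  assumes F: "finite F" "F \<subseteq> V" and vs: "set vs \<subseteq> F \<union> {x \<odot> z |x z. x \<in> U \<and> z \<in> U}"
    and len: "6 + card F < length vs" and u: "u \<in> U"
  shows "act vs u \<in> Z"
proof (cases "set vs \<subseteq> F")
  case True
  show ?thesis
  proof (rule anticommuting_act[OF F(1) subspace_Z, where M = U])
    show "b \<odot> (c \<odot> x) + c \<odot> (b \<odot> x) \<in> Z" if "b \<in> F" "c \<in> F" "x \<in> U" for b c x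
      using that F by (intro V_anticommute) auto
  qed (use True F len u VU_in_U V_mult_Z V_square in auto)
next
  case False
  then obtain x z where "x \<odot> z \<in> set vs" "x \<in> U" "z \<in> U" using vs by blast
  moreover have "set vs \<subseteq> V" using vs F UU_in_V by blast
  ultimately show ?thesis using long_act_with_UU_factor len u by simp
qed


section \<open>Consequences of the Artinian condition\<close>

lemma prod_space_eq: "prod_space scale mult X Y = span {x \<odot> y |x y. x \<in> X \<and> y \<in> Y}"
  by (simp add: prod_space_def)

lemma prod_space_mult: "x \<in> X \<Longrightarrow> y \<in> Y \<Longrightarrow> x \<odot> y \<in> prod_space scale mult X Y"
  unfolding prod_space_eq by (rule span_base) blast

lemma subspace_prod_space [simp]: "subspace (prod_space scale mult X Y)"
  by (simp add: prod_space_eq)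

lemma prod_space_minimal:
  assumes "subspace S" "\<And>x y. x \<in> X \<Longrightarrow> y \<in> Y \<Longrightarrow> x \<odot> y \<in> S"
  shows "prod_space scale mult X Y \<subseteq> S"
  unfolding prod_space_eq by (rule span_minimal) (use assms in auto)

text \<open>
  The algebra is the sum of \<open>K e\<close> and \<open>N\<close>. Stability under \<open>e\<close> says that the subspace is the
  sum of its intersections with \<open>U\<close> and \<open>V\<close>.
\<close>
lemma ideal_in_N:
  assumes "subspace I" "I \<subseteq> N"
    and e: "\<And>x. x \<in> I \<Longrightarrow> e \<odot> x \<in> I" and N: "\<And>n x. n \<in> N \<Longrightarrow> x \<in> I \<Longrightarrow> n \<odot> x \<in> I"
  shows "algebra_ideal scale mult I"
proof -
  have "a \<odot> x \<in> I" if "x \<in> I" for a x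
  proof -
    define n where "n = a - \<omega> a *s e"
    have "n \<in> N"
      using weight_add[of a "- (\<omega> a *s e)"] by (simp add: n_def N_iff weight_minus weight_scale weight_e)
    have "a \<odot> x = n \<odot> x + \<omega> a *s (e \<odot> x)" by (simp add: n_def mult_expand)
    then show ?thesis
      using N[OF \<open>n \<in> N\<close> that] e[OF that] assms(1) by (simp add: subspace_add subspace_scale)
  qed
  moreover have "x \<odot> a \<in> I" if "x \<in> I" for a x
    using calculation[OF that, of a] by (simp add: mult_commute)
  ultimately show ?thesis using assms(1) by (simp add: algebra_ideal_def)
qed

lemma upart_in:
  assumes "subspace I" "\<And>x. x \<in> I \<Longrightarrow> e \<odot> x \<in> I" "x \<in> I"
  shows "upart x \<in> I" "x - upart x \<in> I"
  using assms by (auto simp: upart_def intro!: subspace_add subspace_diff)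

text \<open>
  A product of elements of \<open>U\<close> or \<open>V\<close> lies in \<open>U\<close> or in \<open>V\<close>, so \<open>e\<close> multiplies it by \<open>1/2\<close> or
  \<open>0\<close>.
\<close>
lemma prod_space_N_e_stable:
  assumes I: "subspace I" "I \<subseteq> N" and e: "\<And>x. x \<in> I \<Longrightarrow> e \<odot> x \<in> I"
    and x: "x \<in> prod_space scale mult N I"
  shows "e \<odot> x \<in> prod_space scale mult N I"
  using x unfolding prod_space_eq[of N I]
proof (rule linear_image_span)
  let ?P = "span {x \<odot> y |x y. x \<in> N \<and> y \<in> I}"
  have P: "n \<odot> y \<in> ?P" if "n \<in> N" "y \<in> I" for n y using that by (auto intro: span_base)
  have half: "e \<odot> t \<in> ?P" if "t \<in> U" "t \<in> ?P" for t
    using that by (simp add: e_mult_U span_scale)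
  have zero: "e \<odot> t \<in> ?P" if "t \<in> V" for t
    using that by (simp add: V_iff span_zero)
  fix t assume "t \<in> {x \<odot> y |x y. x \<in> N \<and> y \<in> I}"
  then obtain n y where t: "t = n \<odot> y" and n: "n \<in> N" and y: "y \<in> I" by blast
  define nu nv yu yv where "nu = upart n" and "nv = n - upart n" and "yu = upart y" and "yv = y - upart y"
  have yN: "y \<in> N" using y I by blast
  have m: "nu \<in> U" "nv \<in> V" "yu \<in> U" "yv \<in> V" "yu \<in> I" "yv \<in> I"
    using n y yN upart_in[OF I(1) e y] upart_in_U vpart_in_V
    by (auto simp: nu_def nv_def yu_def yv_def)
  have "t = nu \<odot> yu + nu \<odot> yv + nv \<odot> yu + nv \<odot> yv"
    by (simp add: t nu_def nv_def yu_def yv_def mult_expand)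
  moreover have "e \<odot> (nu \<odot> yu) \<in> ?P" using m by (intro zero UU_in_V)
  moreover have "e \<odot> (nu \<odot> yv) \<in> ?P" using m U_subset_N by (intro half UV_in_U P) auto
  moreover have "e \<odot> (nv \<odot> yu) \<in> ?P" using m V_subset_N by (intro half VU_in_U P) auto
  moreover have "e \<odot> (nv \<odot> yv) \<in> ?P" using m V_subset_N by (intro half VV_in_U P) auto
  ultimately show "e \<odot> t \<in> ?P" by (simp add: mult_add_right span_add)
qed (simp_all add: mult_expand)

text \<open>
  These powers with one factor split off at a time are easier to use than the powers formed
  with all bracketings, and they vanish eventually if and only if the latter do.
\<close>
primrec principal_power :: "nat \<Rightarrow> 'a set" where
  "principal_power 0 = N"
| "principal_power (Suc k) = prod_space scale mult N (principal_power k)"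

lemma principal_power_properties:
  "subspace (principal_power k) \<and> principal_power k \<subseteq> N \<and> principal_power (Suc k) \<subseteq> principal_power k \<and> (\<forall>x \<in> principal_power k. e \<odot> x \<in> principal_power k)"
proof (induction k)
  case 0
  have "prod_space scale mult N N \<subseteq> N"
    by (rule prod_space_minimal) (use subspace_N N_mult in auto)
  then show ?case by (simp add: subspace_N N_mult)
next
  case (Suc k)
  have "\<forall>x \<in> principal_power (Suc k). e \<odot> x \<in> principal_power (Suc k)"
    using Suc prod_space_N_e_stable[of "principal_power k"] by auto
  moreover have "principal_power (Suc (Suc k)) \<subseteq> principal_power (Suc k)"
    unfolding principal_power.simps(2)[of "Suc k"] using Suc
    by (intro prod_space_minimal) (auto intro: prod_space_mult)
  ultimately show ?case using Suc by auto
qed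

lemma principal_power_ideal: "algebra_ideal scale mult (principal_power k)"
proof (rule ideal_in_N)
  show "n \<odot> x \<in> principal_power k" if "n \<in> N" "x \<in> principal_power k" for n x
    using that principal_power_properties[of k] prod_space_mult[of n N x "principal_power k"] by auto
qed (use principal_power_properties in auto)

lemma artinian_stable_ideal:
  assumes "artinian_algebra scale mult"
  obtains k where "principal_power (Suc k) = principal_power k"
proof -
  have "\<exists>m. \<forall>n\<ge>m. principal_power n = principal_power m"
    using assms principal_power_ideal principal_power_properties unfolding artinian_algebra_def by blast
  then obtain m where "\<forall>n\<ge>m. principal_power n = principal_power m" by blast
  then have "principal_power (Suc m) = principal_power m" using le_SucI[OF order_refl] by blast
  then show ?thesis by (rule that)
qed

text \<open>
  Any subspace between \<open>N N\<close> and \<open>N\<close> that is spanned by \<open>N N\<close> and homogeneous elements is an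
  ideal. If \<open>N / N N\<close> had infinite dimension, an infinite sequence of homogeneous elements
  independent modulo \<open>N N\<close> would exist, and its tails together with \<open>N N\<close> would span the
  members of a strictly descending chain of ideals.
\<close>
lemma artinian_finite_mod_square:
  assumes art: "artinian_algebra scale mult"
  shows "\<exists>B. finite B \<and> B \<subseteq> U \<union> V \<and> N = span (B \<union> principal_power 1)"
proof (rule ccontr)
  assume no: "\<nexists>B. finite B \<and> B \<subseteq> U \<union> V \<and> N = span (B \<union> principal_power 1)"
  have ex: "\<exists>x. x \<in> U \<union> V \<and> x \<notin> span (B \<union> principal_power 1)" if B: "finite B" "B \<subseteq> U \<union> V" for B
  proof (rule ccontr)
    assume "\<nexists>x. x \<in> U \<union> V \<and> x \<notin> span (B \<union> principal_power 1)"
    then have UV: "U \<union> V \<subseteq> span (B \<union> principal_power 1)" by blast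
    have "N \<subseteq> span (B \<union> principal_power 1)"
    proof
      fix x assume x: "x \<in> N"
      have "upart x + (x - upart x) \<in> span (B \<union> principal_power 1)"
        using UV upart_in_U[OF x] vpart_in_V[OF x] by (intro span_add) blast+
      then show "x \<in> span (B \<union> principal_power 1)" by simp
    qed
    moreover have "span (B \<union> principal_power 1) \<subseteq> N"
      using B principal_power_properties[of 1] U_subset_N V_subset_N subspace_N by (intro span_minimal) auto
    ultimately show False using no B by blast
  qed
  have "\<exists>f. \<forall>n::nat. f n \<in> U \<union> V \<and> f n \<notin> span (f ` {..<n} \<union> principal_power 1)"
  proof (rule dependent_wellorder_choice)
    fix r and f g :: "nat \<Rightarrow> 'a" and n assume "\<And>y. y < n \<Longrightarrow> f y = g y"
    then have "f ` {..<n} = g ` {..<n}" by auto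
    then show "(r \<in> U \<union> V \<and> r \<notin> span (f ` {..<n} \<union> principal_power 1)) = (r \<in> U \<union> V \<and> r \<notin> span (g ` {..<n} \<union> principal_power 1))"
      by simp
  next
    fix n :: nat and f :: "nat \<Rightarrow> 'a"
    assume "\<And>y. y < n \<Longrightarrow> f y \<in> U \<union> V \<and> f y \<notin> span (f ` {..<y} \<union> principal_power 1)"
    then have "f ` {..<n} \<subseteq> U \<union> V" by blast
    then show "\<exists>r. r \<in> U \<union> V \<and> r \<notin> span (f ` {..<n} \<union> principal_power 1)" by (intro ex) auto
  qed
  then obtain f :: "nat \<Rightarrow> 'a" where fUV: "\<And>n. f n \<in> U \<union> V"
    and f: "\<And>n. f n \<notin> span (f ` {..<n} \<union> principal_power 1)" by blast
  define I where "I n = span (f ` {n..} \<union> principal_power 1)" for n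
  have "algebra_ideal scale mult (I n)" for n
  proof (rule ideal_in_N)
    show "subspace (I n)" by (simp add: I_def)
    show IN: "I n \<subseteq> N"
      unfolding I_def using fUV U_subset_N V_subset_N principal_power_properties[of 1] subspace_N
      by (intro span_minimal) blast+
    show "m \<odot> x \<in> I n" if "m \<in> N" "x \<in> I n" for m x
    proof -
      have "m \<odot> x \<in> principal_power 1" using that IN by (auto intro: prod_space_mult)
      then show ?thesis by (simp add: I_def span_base)
    qed
    show "e \<odot> x \<in> I n" if "x \<in> I n" for x
      using that unfolding I_def
    proof (rule linear_image_span)
      fix y assume y: "y \<in> f ` {n..} \<union> principal_power 1"
      then show "e \<odot> y \<in> span (f ` {n..} \<union> principal_power 1)"
      proof
        assume "y \<in> f ` {n..}"
        then have "y \<in> U \<union> V" using fUV by blast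
        then consider "y \<in> U" | "y \<in> V" by blast
        then show ?thesis
        proof cases
          case 1
          then show ?thesis using span_scale[OF span_base[OF y]] by (simp only: e_mult_U)
        next
          case 2
          then show ?thesis by (simp only: V_iff span_zero)
        qed
      next
        assume "y \<in> principal_power 1"
        then show ?thesis using principal_power_properties[of 1] by (auto intro: span_base)
      qed
    qed (simp_all add: mult_expand)
  qed
  moreover have "I (Suc n) \<subseteq> I n" for n
    unfolding I_def by (rule span_mono) auto
  ultimately have "\<exists>m. \<forall>n\<ge>m. I n = I m"
    using art unfolding artinian_algebra_def by blast
  then obtain m where "\<forall>n\<ge>m. I n = I m" by blast
  then have "I (Suc m) = I m" using le_SucI[OF order_refl] by blast
  moreover have "f m \<in> I m" unfolding I_def by (rule span_base) simp
  ultimately have "f m \<in> span (f ` {Suc m..} \<union> principal_power 1)" unfolding I_def by blast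
  \<comment> \<open>Only finitely many members of the tail are involved in expressing \<open>f m\<close>.\<close>
  then have "\<exists>k. f m \<in> span (f ` {Suc m..<k} \<union> principal_power 1)"
  proof (induction rule: span_induct_alt)
    case base
    show ?case using span_zero by blast
  next
    case (step c x y)
    then obtain k where k: "y \<in> span (f ` {Suc m..<k} \<union> principal_power 1)" by blast
    from step obtain k' where k': "x \<in> f ` {Suc m..<k'} \<union> principal_power 1"
    proof -
      assume *: "\<And>k'. x \<in> f ` {Suc m..<k'} \<union> principal_power 1 \<Longrightarrow> thesis"
      from step(1) show thesis
      proof
        assume "x \<in> f ` {Suc m..}"
        then obtain i where "x = f i" "Suc m \<le> i" by auto
        then show thesis using *[of "Suc i"] by auto
      qed (use * in auto)
    qed
    let ?K = "span (f ` {Suc m..<max k k'} \<union> principal_power 1)"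
    have "y \<in> ?K"
      by (rule set_mp[OF span_mono k]) auto
    moreover have "x \<in> ?K"
      using k' by (intro span_base) auto
    ultimately have "c *s x + y \<in> ?K" by (intro span_add span_scale)
    then show ?case by blast
  qed
  \<comment> \<open>Exchanging \<open>f m\<close> with the last member used contradicts the choice of that member.\<close>
  then obtain k where "f m \<in> span (f ` {Suc m..<k} \<union> principal_power 1)" by blast
  then show False
  proof (induction k)
    case 0
    then have "f m \<in> span (f ` {..<m} \<union> principal_power 1)"
      using span_mono[of "principal_power 1" "f ` {..<m} \<union> principal_power 1"] by auto
    then show False using f by blast
  next
    case (Suc k)
    show False
    proof (cases "Suc m \<le> k")
      case True
      then have "f ` {Suc m..<Suc k} \<union> principal_power 1 = insert (f k) (f ` {Suc m..<k} \<union> principal_power 1)"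
        by (auto simp: less_Suc_eq)
      then have "f k \<in> span (insert (f m) (f ` {Suc m..<k} \<union> principal_power 1))"
        using Suc in_span_insert by metis
      moreover have "insert (f m) (f ` {Suc m..<k} \<union> principal_power 1) \<subseteq> f ` {..<k} \<union> principal_power 1"
        using True by auto
      ultimately show False using f[of k] span_mono by blast
    next
      case False
      then show False using Suc by auto
    qed
  qed
qed


section \<open>The stable power of N\<close>

abbreviation UU where "UU \<equiv> {x \<odot> z |x z. x \<in> U \<and> z \<in> U}"

text \<open>
  Both inclusions are the Peirce components of \<open>N = span B + N N\<close>, since \<open>N N\<close> has the
  components \<open>U V + V V\<close> and \<open>U U\<close>, and \<open>V V \<subseteq> Z\<close>.
\<close>
lemma peirce_generators:
  assumes B: "B \<subseteq> U \<union> V" and N: "N = span (B \<union> principal_power 1)"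
  shows "U \<subseteq> span ((B \<inter> U) \<union> Z \<union> {v \<odot> u |v u. v \<in> V \<and> u \<in> U})"
    and "V \<subseteq> span ((B \<inter> V) \<union> UU)"
proof -
  let ?P = "span ((B \<inter> U) \<union> Z \<union> {v \<odot> u |v u. v \<in> V \<and> u \<in> U})"
  let ?Q = "span ((B \<inter> V) \<union> UU)"
  let ?S = "{x. upart x \<in> ?P \<and> x - upart x \<in> ?Q}"
  \<comment> \<open>It suffices that the generators of \<open>N\<close> have their Peirce components in the two spans.\<close>
  have S: "subspace ?S"
  proof -
    have "upart 0 = 0" by (simp add: upart_def)
    moreover have "x + y - upart (x + y) = (x - upart x) + (y - upart y)"
      "c *s x - upart (c *s x) = c *s (x - upart x)" for x y c
      by (simp_all add: upart_add upart_scale scale_right_diff_distrib)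
    ultimately show ?thesis
      unfolding subspace_def mem_Collect_eq
      by (simp only: upart_add upart_scale diff_zero) (blast intro: span_zero span_add span_scale)
  qed
  have inU: "x \<in> ?S" if "x \<in> U" "x \<in> ?P" for x
    using that span_zero by simp
  have inV: "x \<in> ?S" if "x \<in> V" "x \<in> ?Q" for x
    using that span_zero by simp
  have "principal_power 1 \<subseteq> ?S"
    unfolding One_nat_def principal_power.simps
  proof (rule prod_space_minimal[OF S])
    fix n y assume n: "n \<in> N" and y: "y \<in> N"
    define nu nv yu yv where "nu = upart n" and "nv = n - upart n" and "yu = upart y" and "yv = y - upart y"
    have m: "nu \<in> U" "nv \<in> V" "yu \<in> U" "yv \<in> V"
      using n y by (auto simp: nu_def nv_def yu_def yv_def upart_in_U vpart_in_V)
    have "nu \<odot> yu \<in> ?S" using m by (intro inV UU_in_V span_base) auto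
    moreover have "yv \<odot> nu \<in> ?S" using m by (intro inU VU_in_U span_base) auto
    moreover have "nv \<odot> yu \<in> ?S" using m by (intro inU VU_in_U span_base) auto
    moreover have "nv \<odot> yv \<in> ?S" using m by (intro inU VV_in_U span_base) (auto simp: VV_in_Z)
    ultimately have "nu \<odot> yu + yv \<odot> nu + nv \<odot> yu + nv \<odot> yv \<in> ?S"
      by (intro subspace_add[OF S])
    moreover have "n \<odot> y = nu \<odot> yu + yv \<odot> nu + nv \<odot> yu + nv \<odot> yv"
      by (simp add: mult_commute[of yv nu]) (simp add: nu_def nv_def yu_def yv_def mult_expand)
    ultimately show "n \<odot> y \<in> ?S" by simp
  qed
  moreover have "B \<subseteq> ?S"
  proof
    fix b assume "b \<in> B"
    then consider "b \<in> B \<inter> U" | "b \<in> B \<inter> V" using B by blast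
    then show "b \<in> ?S"
    proof cases
      case 1
      then show ?thesis by (intro inU span_base) auto
    next
      case 2
      then show ?thesis by (intro inV span_base) auto
    qed
  qed
  ultimately have NS: "N \<subseteq> ?S" unfolding N using S by (intro span_minimal) auto
  show "U \<subseteq> ?P"
  proof
    fix u assume "u \<in> U"
    then show "u \<in> ?P" using NS U_subset_N by force
  qed
  show "V \<subseteq> ?Q"
  proof
    fix v assume v: "v \<in> V"
    then have "v \<in> ?S" using NS V_subset_N by blast
    then show "v \<in> ?Q" using v by simp
  qed
qed

text \<open>
  This rewrites \<open>L\<^bsub>u'\<^esub> L\<^sub>u L\<^sub>v\<close> so that an element of \<open>V\<close> acts last; if \<open>G\<close> is stable under
  \<open>V\<close> and under \<open>L\<^bsub>u'\<^esub> L\<^sub>u\<close>, then so is \<open>Z + V G\<close>.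
\<close>
lemma UU_V_mult:
  assumes "u \<in> U" "u' \<in> U" "g \<in> U" "v \<in> V"
  shows "u' \<odot> (u \<odot> (v \<odot> g)) \<approx> ((v \<odot> u) \<odot> u') \<odot> g + - (v \<odot> (u \<odot> (u' \<odot> g)))"
proof -
  have w: "u' \<odot> g \<in> V" using assms by (intro UU_in_V)
  have vu: "v \<odot> u \<in> U" using assms by (intro VU_in_U)
  have "(u' \<odot> g) \<odot> (v \<odot> u) + (g \<odot> (v \<odot> u)) \<odot> u' + ((v \<odot> u) \<odot> u') \<odot> g = 0"
    using assms vu by (intro UUU_cyclic)
  moreover have "(g \<odot> (v \<odot> u)) \<odot> u' = - (u' \<odot> (u \<odot> (v \<odot> g)))"
    using UUV_skew[OF assms(3,1,4)] by (simp add: mult_expand mult_commute[of _ u'])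
  ultimately have eq: "u' \<odot> (u \<odot> (v \<odot> g)) = ((v \<odot> u) \<odot> u') \<odot> g + (u' \<odot> g) \<odot> (v \<odot> u)"
    by (simp add: algebra_simps)
  have "(u' \<odot> g) \<odot> (v \<odot> u) \<approx> - (v \<odot> ((u' \<odot> g) \<odot> u))"
    using assms w by (intro V_swap)
  then show ?thesis
    unfolding eq mult_commute[of u "u' \<odot> g"] by (intro zeq_add zeq_refl)
qed

text \<open>
  Let \<open>H = Z + V G\<close>, \<open>M = G + U G\<close> and \<open>Y = H + U H\<close>. On \<open>M\<close> the operators \<open>L\<^sub>b\<close> with \<open>b \<in> U\<close>
  anticommute modulo \<open>Y\<close>: for arguments in \<open>G\<close> by the cyclic identity, and for arguments in \<open>U
  G \<subseteq> V\<close> by skew-adjointness. Since \<open>U\<close> is spanned by \<open>Z\<close>, \<open>V U\<close> and the finite set \<open>E = B \<inter>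
  U\<close>, where \<open>Z\<close> and \<open>V U\<close> contribute only terms in \<open>Y\<close>, the inclusion \<open>M \<subseteq> Y + E M\<close> holds, and
  iterating it gives \<open>M \<subseteq> Y\<close>. The \<open>U\<close>-component of this is \<open>G \<subseteq> Z + V G\<close>; iterating once more
  and using that long words in generators of \<open>V\<close> map into \<open>Z\<close> completes the proof.
\<close>
lemma stable_subspace_in_Z:
  assumes B: "finite B" "B \<subseteq> U \<union> V" "N = span (B \<union> principal_power 1)"
    and G: "subspace G" "G \<subseteq> U" "Z \<subseteq> G"
    and VG: "\<And>v g. v \<in> V \<Longrightarrow> g \<in> G \<Longrightarrow> v \<odot> g \<in> G"
    and UUG: "\<And>u u' g. u \<in> U \<Longrightarrow> u' \<in> U \<Longrightarrow> g \<in> G \<Longrightarrow> u \<odot> (u' \<odot> g) \<in> G"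
    and gen: "G \<subseteq> span (Z \<union> {v \<odot> g |v g. v \<in> V \<and> g \<in> G}
        \<union> {u \<odot> (u' \<odot> g) |u u' g. u \<in> U \<and> u' \<in> U \<and> g \<in> G})"
  shows "G \<subseteq> Z"
proof -
  define E where "E = B \<inter> U"
  define F where "F = B \<inter> V"
  have E: "finite E" "E \<subseteq> U" and F: "finite F" "F \<subseteq> V" using B by (auto simp: E_def F_def)
  note U_gen = peirce_generators(1)[OF B(2,3), folded E_def]
  note V_gen = peirce_generators(2)[OF B(2,3), folded F_def]
  define H where "H = span (Z \<union> {v \<odot> g |v g. v \<in> V \<and> g \<in> G})"
  have sH: "subspace H" by (simp add: H_def)
  have ZH: "z \<in> H" if "z \<in> Z" for z using that by (simp add: H_def span_base)
  have VGH: "v \<odot> g \<in> H" if "v \<in> V" "g \<in> G" for v g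
    unfolding H_def by (rule span_base) (use that in blast)
  have HG: "H \<subseteq> G" unfolding H_def using G VG by (intro span_minimal) auto
  have zeq_H: "x \<in> H" if "x \<approx> y" "y \<in> H" for x y
    using subspace_add[OF sH ZH that(2), of "x - y"] that(1) by (simp add: zeq_def)
  have UUH: "u' \<odot> (u \<odot> h) \<in> H" if "u \<in> U" "u' \<in> U" "h \<in> H" for u u' h
    using that(3)[unfolded H_def]
  proof (rule linear_image_span[OF _ _ sH])
    fix x assume "x \<in> Z \<union> {v \<odot> g |v g. v \<in> V \<and> g \<in> G}"
    then show "u' \<odot> (u \<odot> x) \<in> H"
    proof
      assume "x \<in> Z"
      then show ?thesis using that U_mult_Z sH by (simp add: subspace_0)
    next
      assume "x \<in> {v \<odot> g |v g. v \<in> V \<and> g \<in> G}"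
      then obtain v g where x: "x = v \<odot> g" and v: "v \<in> V" and g: "g \<in> G" by blast
      have "((v \<odot> u) \<odot> u') \<odot> g + - (v \<odot> (u \<odot> (u' \<odot> g))) \<in> H"
        using that v g UUG by (intro subspace_add[OF sH] subspace_neg[OF sH] VGH UU_in_V VU_in_U)
      then show ?thesis unfolding x
        using that v g G by (intro zeq_H[OF UU_V_mult]) auto
    qed
  qed (simp_all add: mult_expand)
  let ?UG = "{u \<odot> g |u g. u \<in> U \<and> g \<in> G}"
  define M where "M = span (G \<union> ?UG)"
  define Y where "Y = span (H \<union> {u \<odot> h |u h. u \<in> U \<and> h \<in> H})"
  have sY: "subspace Y" by (simp add: Y_def)
  have HY: "h \<in> Y" if "h \<in> H" for h using that by (simp add: Y_def span_base)
  have UHY: "u \<odot> h \<in> Y" if "u \<in> U" "h \<in> H" for u h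
    unfolding Y_def by (rule span_base) (use that in blast)
  have UM: "u \<odot> x \<in> M" if u: "u \<in> U" and x: "x \<in> M" for u x
    using x unfolding M_def
  proof (rule linear_image_span)
    fix y assume "y \<in> G \<union> ?UG"
    then have "u \<odot> y \<in> G \<union> ?UG" using u UUG by blast
    then show "u \<odot> y \<in> span (G \<union> ?UG)" by (rule span_base)
  qed (simp_all add: mult_expand)
  have UY: "u \<odot> x \<in> Y" if u: "u \<in> U" and x: "x \<in> Y" for u x
    using x unfolding Y_def
  proof (rule linear_image_span)
    fix y assume "y \<in> H \<union> {u \<odot> h |u h. u \<in> U \<and> h \<in> H}"
    then have "u \<odot> y \<in> H \<union> {u \<odot> h |u h. u \<in> U \<and> h \<in> H}" using u UUH by blast
    then show "u \<odot> y \<in> span (H \<union> {u \<odot> h |u h. u \<in> U \<and> h \<in> H})" by (rule span_base)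
  qed (simp_all add: mult_expand)
  have anti: "b \<odot> (c \<odot> x) + c \<odot> (b \<odot> x) \<in> Y" if b: "b \<in> U" and c: "c \<in> U" and x: "x \<in> M" for b c x
    using x unfolding M_def
  proof (rule linear_image_span[OF _ _ sY])
    fix y assume "y \<in> G \<union> ?UG"
    then show "b \<odot> (c \<odot> y) + c \<odot> (b \<odot> y) \<in> Y"
    proof
      assume y: "y \<in> G"
      have "(b \<odot> c) \<odot> y + (c \<odot> y) \<odot> b + (y \<odot> b) \<odot> c = 0"
        using b c y G by (intro UUU_cyclic) auto
      moreover have "(c \<odot> y) \<odot> b = b \<odot> (c \<odot> y)" by (rule mult_commute)
      moreover have "(y \<odot> b) \<odot> c = c \<odot> (b \<odot> y)"
        unfolding mult_commute[of y b] by (rule mult_commute)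
      ultimately have "b \<odot> (c \<odot> y) + c \<odot> (b \<odot> y) = - ((b \<odot> c) \<odot> y)"
        by (simp add: eq_neg_iff_add_eq_0 algebra_simps)
      then show ?thesis using VGH[OF UU_in_V[OF b c] y] by (simp add: HY subspace_neg[OF sH])
    next
      assume "y \<in> ?UG"
      then have "y \<in> V" using G UU_in_V by auto
      then have "b \<odot> (c \<odot> y) + c \<odot> (b \<odot> y) = 0"
        using UUV_skew[OF b c \<open>y \<in> V\<close>] by (simp add: mult_commute[of y b] mult_commute[of y c])
      then show ?thesis using subspace_0[OF sY] by simp
    qed
  qed (simp_all add: mult_expand scale_right_distrib algebra_simps)
  have sq: "b \<odot> (b \<odot> x) \<in> Y" if "b \<in> U" "x \<in> M" for b x
    using anti[OF that(1) that] by (rule subspace_half[OF sY])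
  have "M \<subseteq> span (Y \<union> {b \<odot> x |b x. b \<in> E \<and> x \<in> M})"
  proof -
    let ?R = "span (Y \<union> {b \<odot> x |b x. b \<in> E \<and> x \<in> M})"
    have YR: "y \<in> ?R" if "y \<in> Y" for y using that by (simp add: span_base)
    have ER: "b \<odot> x \<in> ?R" if "b \<in> E" "x \<in> M" for b x by (rule span_base) (use that in blast)
    have MG: "g \<in> M" if "g \<in> G" for g using that by (simp add: M_def span_base)
    have MUG: "u \<odot> g \<in> M" if "u \<in> U" "g \<in> G" for u g using that UM MG by blast
    have UGR: "u \<odot> g \<in> ?R" if u: "u \<in> U" and g: "g \<in> G" for u g
      using set_mp[OF U_gen u]
    proof (rule linear_image_span)
      fix x assume x: "x \<in> E \<union> Z \<union> {v \<odot> u |v u. v \<in> V \<and> u \<in> U}"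
      have gU: "g \<in> U" using g G by blast
      from x consider "x \<in> E" | "x \<in> Z" | v u where "x = v \<odot> u" "v \<in> V" "u \<in> U" by blast
      then show "x \<odot> g \<in> ?R"
      proof cases
        case 1
        then show ?thesis using g MG by (intro ER)
      next
        case 2
        then show ?thesis using gU by (simp add: Z_def span_zero)
      next
        case 3
        have "x \<odot> g = - (u \<odot> (v \<odot> g))"
          unfolding 3(1) mult_commute[of "v \<odot> u" g] by (rule UUV_skew[OF gU 3(3,2)])
        then show ?thesis using UHY[OF 3(3) VGH[OF 3(2) g]] by (simp add: YR subspace_neg[OF sY])
      qed
    qed (simp_all add: mult_expand)
    have UUGR: "u \<odot> (u' \<odot> g) \<in> ?R" if u: "u \<in> U" and u': "u' \<in> U" and g: "g \<in> G" for u u' g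
      using set_mp[OF U_gen u]
    proof (rule linear_image_span)
      fix x assume x: "x \<in> E \<union> Z \<union> {v \<odot> u |v u. v \<in> V \<and> u \<in> U}"
      have w: "u' \<odot> g \<in> V" using u' g G by (intro UU_in_V) auto
      from x consider "x \<in> E" | "x \<in> Z" | v u where "x = v \<odot> u" "v \<in> V" "u \<in> U" by blast
      then show "x \<odot> (u' \<odot> g) \<in> ?R"
      proof cases
        case 1
        then show ?thesis using u' g by (intro ER MUG)
      next
        case 2
        then have "x \<odot> (u' \<odot> g) \<in> Z" using V_mult_Z[OF w] by (simp add: mult_commute[of x])
        then show ?thesis by (intro YR HY ZH)
      next
        case 3
        have "(u' \<odot> g) \<odot> (v \<odot> u) \<approx> - (v \<odot> ((u' \<odot> g) \<odot> u))" using w 3 by (intro V_swap)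
        then have "x \<odot> (u' \<odot> g) \<approx> - (v \<odot> (u \<odot> (u' \<odot> g)))"
          unfolding 3(1) by (simp add: mult_commute[of _ "u' \<odot> g"])
        moreover have "- (v \<odot> (u \<odot> (u' \<odot> g))) \<in> H"
          using 3 u' g by (intro subspace_neg[OF sH] VGH UUG)
        ultimately have "x \<odot> (u' \<odot> g) \<in> H" by (rule zeq_H)
        then show ?thesis by (intro YR HY)
      qed
    qed (simp_all add: mult_expand)
    have "Z \<union> {v \<odot> g |v g. v \<in> V \<and> g \<in> G}
        \<union> {u \<odot> (u' \<odot> g) |u u' g. u \<in> U \<and> u' \<in> U \<and> g \<in> G} \<subseteq> ?R"
      using UUGR VGH HY YR ZH by auto
    from order_trans[OF gen span_minimal[OF this subspace_span]] have "G \<subseteq> ?R" .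
    moreover have "?UG \<subseteq> ?R" using UGR by blast
    ultimately have "span (G \<union> ?UG) \<subseteq> ?R" by (intro span_minimal subspace_span) simp
    then show ?thesis unfolding M_def[symmetric] .
  qed
  then have "M \<subseteq> span (Y \<union> {act cs x |cs x. set cs \<subseteq> E \<and> length cs = Suc (card E) \<and> x \<in> M})"
    by (rule subset_span_act) (use sY UY E in auto)
  also have "\<dots> \<subseteq> Y"
  proof (rule span_minimal[OF _ sY])
    have "act cs x \<in> Y" if "set cs \<subseteq> E" "length cs = Suc (card E)" "x \<in> M" for cs x
    proof (rule anticommuting_act[OF E(1) sY, where M = M])
      show "b \<odot> (c \<odot> x) + c \<odot> (b \<odot> x) \<in> Y" if "b \<in> E" "c \<in> E" "x \<in> M" for b c x
        using that E by (intro anti) auto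
    qed (use that E UM UY sq in auto)
    then show "Y \<union> {act cs x |cs x. set cs \<subseteq> E \<and> length cs = Suc (card E) \<and> x \<in> M} \<subseteq> Y" by blast
  qed
  finally have MY: "M \<subseteq> Y" .
  have upart_Y: "upart y \<in> H" if "y \<in> Y" for y
    using that unfolding Y_def
  proof (rule linear_image_span[OF _ _ sH])
    fix x assume "x \<in> H \<union> {u \<odot> h |u h. u \<in> U \<and> h \<in> H}"
    then show "upart x \<in> H"
    proof
      assume "x \<in> H"
      then show ?thesis using HG G by auto
    next
      assume "x \<in> {u \<odot> h |u h. u \<in> U \<and> h \<in> H}"
      then have "x \<in> V" using HG G UU_in_V by auto
      then show ?thesis using subspace_0[OF sH] by simp
    qed
  qed (simp_all add: upart_add upart_scale)
  \<comment> \<open>Taking \<open>U\<close>-components removes the summand \<open>U H \<subseteq> V\<close> of \<open>Y\<close>.\<close>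
  have GH: "G \<subseteq> H"
  proof
    fix g assume g: "g \<in> G"
    then have "upart g \<in> H" using MY by (intro upart_Y) (auto simp: M_def intro: span_base)
    then show "g \<in> H" using g G by auto
  qed
  let ?C = "F \<union> UU"
  have "G \<subseteq> span (Z \<union> {c \<odot> g |c g. c \<in> ?C \<and> g \<in> G})"
  proof -
    have "v \<odot> g \<in> span (Z \<union> {c \<odot> g |c g. c \<in> ?C \<and> g \<in> G})" if "v \<in> V" "g \<in> G" for v g
      using set_mp[OF V_gen that(1)]
      by (rule linear_image_span) (use that in \<open>auto simp: mult_expand intro!: span_base\<close>)
    then have "H \<subseteq> span (Z \<union> {c \<odot> g |c g. c \<in> ?C \<and> g \<in> G})"
      unfolding H_def by (intro span_minimal) (auto intro: span_base)
    then show ?thesis using GH by blast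
  qed
  then have "G \<subseteq> span (Z \<union> {act cs g |cs g. set cs \<subseteq> ?C \<and> length cs = 7 + card F \<and> g \<in> G})"
  proof (rule subset_span_act[OF _ subspace_Z])
    show "c \<odot> z \<in> Z" if "c \<in> ?C" "z \<in> Z" for c z
      using that F UU_in_V by (intro V_mult_Z) auto
  qed
  also have "\<dots> \<subseteq> Z"
  proof (rule span_minimal[OF _ subspace_Z])
    have "act cs g \<in> Z" if "set cs \<subseteq> ?C" "length cs = 7 + card F" "g \<in> G" for cs g
      using that G by (intro long_act_in_Z[OF F]) auto
    then show "Z \<union> {act cs g |cs g. set cs \<subseteq> ?C \<and> length cs = 7 + card F \<and> g \<in> G} \<subseteq> Z" by blast
  qed
  finally show ?thesis .
qed

text \<open>
  The Peirce components of \<open>J = N J\<close> give the generation hypothesis of \<open>stable_subspace_in_Z\<close>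
  for \<open>G = (J \<inter> U) + Z\<close>. Once \<open>J \<inter> U \<subseteq> Z\<close> is known, \<open>J \<inter> V = U (J \<inter> U) = 0\<close>; so \<open>U J = 0\<close> and
  \<open>J = N J = V J\<close>.
\<close>
lemma stable_ideal_zero:
  assumes art: "artinian_algebra scale mult"
    and no: "\<And>I. subspace I \<Longrightarrow> prod_space scale mult V I = I \<Longrightarrow> I = {0}"
    and k: "principal_power (Suc k) = principal_power k"
  shows "principal_power k = {0}"
proof -
  define J where "J = principal_power k"
  have J: "subspace J" "J \<subseteq> N" "\<And>x. x \<in> J \<Longrightarrow> e \<odot> x \<in> J" and JN: "prod_space scale mult N J = J"
    using principal_power_properties[of k] k by (auto simp: J_def)
  have NJ: "n \<odot> x \<in> J" if "n \<in> N" "x \<in> J" for n x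
    using prod_space_mult[OF that] JN by simp
  define G where "G = {j + z |j z. j \<in> J \<inter> U \<and> z \<in> Z}"
  have G_J: "j \<in> G" if "j \<in> J" "j \<in> U" for j
    using that subspace_0[OF subspace_Z] unfolding G_def by force
  have ZG: "Z \<subseteq> G"
    using subspace_0[OF J(1)] subspace_0[OF subspace_U] unfolding G_def by force
  have sG: "subspace G"
    unfolding G_def by (intro subspace_sums subspace_inter J subspace_U subspace_Z)
  have GU: "G \<subseteq> U" unfolding G_def using Z_subset_U by (auto intro: subspace_add subspace_U)
  have VG: "v \<odot> g \<in> G" if "v \<in> V" "g \<in> G" for v g
    using that NJ V_subset_N VU_in_U V_mult_Z unfolding G_def by (fastforce simp: mult_add_right)
  have UUG: "u \<odot> (u' \<odot> g) \<in> G" if u: "u \<in> U" "u' \<in> U" and g: "g \<in> G" for u u' g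
  proof -
    obtain j z where g_eq: "g = j + z" and j: "j \<in> J" "j \<in> U" and z: "z \<in> Z" using g by (auto simp: G_def)
    have "u \<odot> (u' \<odot> g) = u \<odot> (u' \<odot> j)" using u z by (simp add: g_eq mult_add_right U_mult_Z)
    moreover have "u \<odot> (u' \<odot> j) \<in> J" using u j U_subset_N by (intro NJ) auto
    moreover have "u \<odot> (u' \<odot> j) \<in> U" using u j by (intro UV_in_U UU_in_V)
    ultimately show ?thesis using G_J by simp
  qed
  let ?R = "span (Z \<union> {v \<odot> g |v g. v \<in> V \<and> g \<in> G}
        \<union> {u \<odot> (u' \<odot> g) |u u' g. u \<in> U \<and> u' \<in> U \<and> g \<in> G})"
  let ?Q = "span {u \<odot> g |u g. u \<in> U \<and> g \<in> G}"
  have part: "upart x \<in> J" "x - upart x \<in> J" "upart x \<in> G" "upart x \<in> U" "x - upart x \<in> V"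
    if "x \<in> J" for x
    using that upart_in[OF J(1,3)] upart_in_U vpart_in_V J(2) G_J by auto
  have J_span: "x \<in> span {x \<odot> y |x y. x \<in> N \<and> y \<in> J}" if "x \<in> J" for x
    using that JN unfolding prod_space_eq by blast
  \<comment> \<open>Among the products of Peirce components only \<open>U (J \<inter> U)\<close> lies in \<open>V\<close>.\<close>
  have J_V: "x - upart x \<in> ?Q" if "x \<in> J" for x
    using J_span[OF that]
  proof (rule linear_image_span)
    fix t assume "t \<in> {x \<odot> y |x y. x \<in> N \<and> y \<in> J}"
    then obtain n y where t: "t = n \<odot> y" and n: "n \<in> N" and y: "y \<in> J" by blast
    define nu nv yu yv where "nu = upart n" and "nv = n - upart n" and "yu = upart y" and "yv = y - upart y"
    have m: "nu \<in> U" "nv \<in> V" "yu \<in> U" "yv \<in> V" "yu \<in> G"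
      using n y part by (auto simp: nu_def nv_def yu_def yv_def upart_in_U vpart_in_V)
    have "t = nu \<odot> yu + nu \<odot> yv + nv \<odot> yu + nv \<odot> yv"
      by (simp add: t nu_def nv_def yu_def yv_def mult_expand)
    then have "t - upart t = nu \<odot> yu"
      using m by (simp add: upart_add UU_in_V UV_in_U VU_in_U VV_in_U)
    then show "t - upart t \<in> ?Q" using m by (auto intro: span_base)
  qed (simp_all add: upart_add upart_scale scale_right_diff_distrib)
  have UQ: "u \<odot> x \<in> ?R" if "u \<in> U" "x \<in> ?Q" for u x
    using that(2) by (rule linear_image_span) (use that(1) in \<open>auto simp: mult_expand intro!: span_base\<close>)
  have J_U: "upart x \<in> ?R" if "x \<in> J" for x
    using J_span[OF that]
  proof (rule linear_image_span)
    fix t assume "t \<in> {x \<odot> y |x y. x \<in> N \<and> y \<in> J}"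
    then obtain n y where t: "t = n \<odot> y" and n: "n \<in> N" and y: "y \<in> J" by blast
    define nu nv yu yv where "nu = upart n" and "nv = n - upart n" and "yu = upart y" and "yv = y - upart y"
    have m: "nu \<in> U" "nv \<in> V" "yu \<in> U" "yv \<in> V" "yu \<in> G" "yv \<in> ?Q"
      using n y part J_V[OF y] by (auto simp: nu_def nv_def yu_def yv_def upart_in_U vpart_in_V)
    have "t = nu \<odot> yu + nu \<odot> yv + nv \<odot> yu + nv \<odot> yv"
      by (simp add: t nu_def nv_def yu_def yv_def mult_expand)
    then have "upart t = nu \<odot> yv + nv \<odot> yu + nv \<odot> yv"
      using m by (simp add: upart_add UU_in_V UV_in_U VU_in_U VV_in_U)
    moreover have "nu \<odot> yv \<in> ?R" using m by (intro UQ)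
    moreover have "nv \<odot> yu \<in> ?R" using m by (intro span_base) blast
    moreover have "nv \<odot> yv \<in> ?R" using m by (intro span_base) (simp add: VV_in_Z)
    ultimately show "upart t \<in> ?R" by (simp add: span_add)
  qed (simp_all add: upart_add upart_scale)
  have gen: "G \<subseteq> ?R"
  proof
    fix g assume "g \<in> G"
    then obtain j z where g: "g = j + z" and j: "j \<in> J" "j \<in> U" and z: "z \<in> Z" by (auto simp: G_def)
    have "j \<in> ?R" using J_U[OF j(1)] j(2) by simp
    moreover have "z \<in> ?R" using z by (simp add: span_base)
    ultimately show "g \<in> ?R" unfolding g by (rule span_add)
  qed
  obtain B where B: "finite B" "B \<subseteq> U \<union> V" "N = span (B \<union> principal_power 1)"
    using artinian_finite_mod_square[OF art] by blast
  have GZ: "G \<subseteq> Z" by (rule stable_subspace_in_Z[OF B sG GU ZG VG UUG gen])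
  have JZ: "J \<subseteq> Z"
  proof
    fix x assume x: "x \<in> J"
    have "?Q \<subseteq> {0}" using GZ U_mult_Z by (intro span_minimal) auto
    then have "x = upart x" using J_V[OF x] by auto
    then show "x \<in> Z" using part[OF x] GZ by auto
  qed
  have "prod_space scale mult V J = J"
  proof
    show "prod_space scale mult V J \<subseteq> J"
      by (rule prod_space_minimal[OF J(1)]) (use NJ V_subset_N in auto)
    have "prod_space scale mult N J \<subseteq> prod_space scale mult V J"
    proof (rule prod_space_minimal)
      fix n x assume n: "n \<in> N" and x: "x \<in> J"
      have "n \<odot> x = upart n \<odot> x + (n - upart n) \<odot> x" by (simp add: mult_expand)
      also have "upart n \<odot> x = 0" using upart_in_U[OF n] x JZ U_mult_Z by blast
      finally have "n \<odot> x = (n - upart n) \<odot> x" by simp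
      then show "n \<odot> x \<in> prod_space scale mult V J"
        using prod_space_mult[OF vpart_in_V[OF n] x] by simp
    qed simp
    then show "J \<subseteq> prod_space scale mult V J" unfolding JN .
  qed
  then show ?thesis using no J(1) unfolding J_def by blast
qed


section \<open>Powers of N and of the multiplication algebra\<close>

abbreviation N_power where "N_power \<equiv> alg_power scale mult N"

lemma alg_power_1: "alg_power s m B (Suc 0) = B"
  by (subst alg_power.simps) simp

lemma N_power_subset_N: "1 \<le> n \<Longrightarrow> subspace (N_power n) \<and> N_power n \<subseteq> N"
proof (induction n rule: less_induct)
  case (less n)
  show ?case
  proof (cases "n \<le> 1")
    case True
    then show ?thesis using subspace_N by (subst (1 2) alg_power.simps) simp
  next
    case False
    have "prod_space scale mult (N_power r) (N_power (n - r)) \<subseteq> N" if r: "r \<in> {1..<n}" for r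
    proof (rule prod_space_minimal[OF subspace_N])
      fix x y assume "y \<in> N_power (n - r)"
      moreover have "N_power (n - r) \<subseteq> N" using less.IH[of "n - r"] r by (simp add: Suc_le_eq)
      ultimately show "x \<odot> y \<in> N" using N_mult by blast
    qed
    then have "span (\<Union>r\<in>{1..<n}. prod_space scale mult (N_power r) (N_power (n - r))) \<subseteq> N"
      by (intro span_minimal subspace_N) blast
    then show ?thesis using False by (subst (1 2) alg_power.simps) simp
  qed
qed

lemma N_power_mult:
  assumes "1 \<le> r" "1 \<le> s" "x \<in> N_power r" "y \<in> N_power s"
  shows "x \<odot> y \<in> N_power (r + s)"
proof -
  have "x \<odot> y \<in> prod_space scale mult (N_power r) (N_power (r + s - r))"
    using assms by (intro prod_space_mult) auto
  moreover have "r \<in> {1..<r + s}" using assms by auto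
  ultimately have "x \<odot> y \<in> span (\<Union>q\<in>{1..<r + s}. prod_space scale mult (N_power q) (N_power (r + s - q)))"
    by (intro span_base) blast
  then show ?thesis
    using assms by (subst alg_power.simps) simp
qed

lemma N_power_minimal:
  assumes "2 \<le> n" "subspace S"
    and "\<And>r s x y. 1 \<le> r \<Longrightarrow> 1 \<le> s \<Longrightarrow> n = r + s \<Longrightarrow> x \<in> N_power r \<Longrightarrow> y \<in> N_power s \<Longrightarrow> x \<odot> y \<in> S"
  shows "N_power n \<subseteq> S"
proof -
  have "prod_space scale mult (N_power r) (N_power (n - r)) \<subseteq> S" if "r \<in> {1..<n}" for r
    using that assms(3)[of r "n - r"] by (intro prod_space_minimal assms(2)) auto
  then have "span (\<Union>r\<in>{1..<n}. prod_space scale mult (N_power r) (N_power (n - r))) \<subseteq> S"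
    by (intro span_minimal assms(2)) blast
  then show ?thesis
    using assms(1) by (subst alg_power.simps) simp
qed

lemma N_power_decreasing: "1 \<le> n \<Longrightarrow> N_power (Suc n) \<subseteq> N_power n"
proof (induction n rule: less_induct)
  case (less n)
  show ?case
  proof (rule N_power_minimal)
    fix r s x y
    assume rs: "1 \<le> r" "1 \<le> s" "Suc n = r + s" and x: "x \<in> N_power r" and y: "y \<in> N_power s"
    show "x \<odot> y \<in> N_power n"
    proof (cases "r = 1")
      case False
      then obtain r' where r': "r = Suc r'" "1 \<le> r'" using rs by (cases r) auto
      then have "x \<in> N_power r'" using less.IH[of r'] rs x by auto
      then show ?thesis using N_power_mult[OF r'(2) rs(2) _ y] rs r' by simp
    next
      case True
      then have s: "s = n" using rs by simp
      show ?thesis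
      proof (cases "n = 1")
        case True
        then show ?thesis using N_mult y s by (simp add: alg_power_1)
      next
        case False
        then obtain n' where n': "n = Suc n'" "1 \<le> n'" using less.prems by (cases n) auto
        then have "y \<in> N_power n'" using less.IH[of n'] y s by auto
        then show ?thesis using N_power_mult[OF rs(1) n'(2) x] n' \<open>r = 1\<close> by simp
      qed
    qed
  qed (use less.prems N_power_subset_N in auto)
qed

text \<open>
  In a product of twice \<open>2\<^sup>k\<close> or more factors, one of the two outermost factors is itself a
  product of at least \<open>2\<^sup>k\<close> factors.
\<close>
lemma N_power_subset_principal_power: "2 ^ k \<le> n \<Longrightarrow> N_power n \<subseteq> principal_power k"
proof (induction k arbitrary: n)
  case 0
  then show ?case using N_power_subset_N by simp
next
  case (Suc k)
  have "(1::nat) \<le> 2 ^ k" by simp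
  then have two: "2 \<le> n" using Suc.prems unfolding power_Suc by linarith
  show ?case
  proof (rule N_power_minimal[OF two])
    fix r s x y
    assume rs: "1 \<le> r" "1 \<le> s" "n = r + s" and x: "x \<in> N_power r" and y: "y \<in> N_power s"
    have xN: "x \<in> N" and yN: "y \<in> N" using x y rs N_power_subset_N by blast+
    have "2 ^ k \<le> r \<or> 2 ^ k \<le> s" using Suc.prems rs by auto
    then show "x \<odot> y \<in> principal_power (Suc k)"
    proof
      assume "2 ^ k \<le> r"
      then have "y \<odot> x \<in> principal_power (Suc k)" using Suc.IH x yN by (auto intro: prod_space_mult)
      then show ?thesis by (simp only: mult_commute[of x y])
    next
      assume "2 ^ k \<le> s"
      then show ?thesis using Suc.IH y xN by (auto intro: prod_space_mult)
    qed
  qed simp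
qed

lemma nilpotent_if_principal_power_zero: "principal_power k = {0} \<Longrightarrow> nilpotent_algebra scale mult N"
proof -
  assume "principal_power k = {0}"
  then have "N_power (2 ^ k) \<subseteq> {0}" using N_power_subset_principal_power[of k "2 ^ k"] by simp
  moreover have "0 \<in> N_power (2 ^ k)" using N_power_subset_N[of "2 ^ k"] subspace_0 by simp
  ultimately show ?thesis unfolding nilpotent_algebra_def
    by (intro exI[of _ "2 ^ k"]) auto
qed

abbreviation mult_alg where "mult_alg \<equiv> mult_algebra scale mult N V"
abbreviation mult_alg_power where "mult_alg_power \<equiv> alg_power (fun_scale scale) (\<circ>) mult_alg"

lemma module_fun_scale: "module (fun_scale scale)"
  by unfold_locales (simp_all add: fun_scale_def fun_eq_iff scale_expand)

sublocale fn: module "fun_scale scale"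
  by (rule module_fun_scale)

lemma left_mult_endo: "left_mult mult N v \<in> endo scale N"
  using subspace_N N_mult by (simp add: endo_def left_mult_def mult_expand subspace_add subspace_scale)

definition raising :: "nat \<Rightarrow> ('a \<Rightarrow> 'a) set" where
  "raising k = {f \<in> endo scale N. \<forall>r\<ge>1. \<forall>x \<in> N_power r. f x \<in> N_power (r + k)}"

lemma N_power_antimono: "1 \<le> m \<Longrightarrow> m \<le> n \<Longrightarrow> N_power n \<subseteq> N_power m"
proof (induction n)
  case (Suc n)
  then show ?case using N_power_decreasing[of n] by (cases "m = Suc n") auto
qed simp

lemma endo_0: "f \<in> endo scale N \<Longrightarrow> f 0 = 0"
  using subspace_0[OF subspace_N] by (simp add: endo_def) (metis scale_zero_left)

lemma raising_subspace: "fn.subspace (raising k)"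
proof -
  have sub: "subspace (N_power (r + k))" if "1 \<le> r" for r using N_power_subset_N[of "r + k"] that by simp
  have "0 \<in> endo scale N" using subspace_0[OF subspace_N] by (simp add: endo_def)
  moreover have "f + g \<in> endo scale N" if "f \<in> endo scale N" "g \<in> endo scale N" for f g
    using that subspace_add[OF subspace_N] by (simp add: endo_def scale_right_distrib)
  moreover have "fun_scale scale c f \<in> endo scale N" if "f \<in> endo scale N" for f c
    using that subspace_scale[OF subspace_N]
    by (simp add: endo_def fun_scale_def scale_right_distrib mult.commute)
  ultimately show ?thesis
    unfolding fn.subspace_def using sub
    by (simp add: raising_def subspace_0 subspace_add fun_scale_def subspace_scale)
qed

lemma raising_comp:
  assumes f: "f \<in> raising k" and g: "g \<in> raising l"
  shows "f \<circ> g \<in> raising (l + k)"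
proof -
  have "f (g x) \<in> N_power (r + (l + k))" if r: "1 \<le> r" "x \<in> N_power r" for r x
  proof -
    have "g x \<in> N_power (r + l)" using g r by (simp add: raising_def)
    then have "f (g x) \<in> N_power (r + l + k)" using f r by (simp add: raising_def)
    then show ?thesis by (simp add: add.assoc)
  qed
  moreover have "f \<circ> g \<in> endo scale N"
    using f g endo_0[of f] by (simp add: raising_def endo_def)
  ultimately show ?thesis by (simp add: raising_def)
qed

text \<open>
  The multiplication algebra is the least subalgebra containing the generators, and \<open>raising
  1\<close> is a subalgebra because the powers of \<open>N\<close> decrease.
\<close>
lemma mult_alg_raising: "mult_alg \<subseteq> raising 1"
  unfolding mult_algebra_def
proof (rule hull_minimal)
  show "left_mult mult N ` V \<subseteq> raising 1"
  proof
    fix f assume "f \<in> left_mult mult N ` V"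
    then obtain v where f: "f = left_mult mult N v" and v: "v \<in> N" using V_subset_N by blast
    have "f x \<in> N_power (r + 1)" if "1 \<le> r" "x \<in> N_power r" for r x
    proof -
      have "x \<in> N" using that N_power_subset_N by blast
      then show ?thesis
        using N_power_mult[of 1 r v x] v that by (simp add: f left_mult_def alg_power_1)
    qed
    then show "f \<in> raising 1" using left_mult_endo by (simp add: raising_def f)
  qed
  have "f \<circ> g \<in> raising 1" if "f \<in> raising 1" "g \<in> raising 1" for f g
  proof -
    have "f \<circ> g \<in> raising 2" using raising_comp[OF that] by (simp add: numeral_2_eq_2)
    moreover have "N_power (r + 2) \<subseteq> N_power (r + 1)" if "1 \<le> r" for r
      using that by (intro N_power_antimono) auto
    ultimately show ?thesis unfolding raising_def by blast
  qed
  moreover have "raising 1 \<subseteq> endo scale N" by (auto simp: raising_def)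
  ultimately show "endo_subalgebra scale N (raising 1)"
    using raising_subspace by (simp add: endo_subalgebra_def)
qed

lemma mult_alg_power_raising: "1 \<le> k \<Longrightarrow> mult_alg_power k \<subseteq> raising k"
proof (induction k rule: less_induct)
  case (less k)
  show ?case
  proof (cases "k = 1")
    case True
    then show ?thesis using mult_alg_raising by (simp add: alg_power_1)
  next
    case False
    have "prod_space (fun_scale scale) (\<circ>) (mult_alg_power r) (mult_alg_power (k - r)) \<subseteq> raising k" if r: "r \<in> {1..<k}" for r
      unfolding prod_space_def
    proof (rule fn.span_minimal[OF _ raising_subspace])
      have "f \<circ> g \<in> raising k" if "f \<in> mult_alg_power r" "g \<in> mult_alg_power (k - r)" for f g
      proof -
        have "f \<in> raising r" using less.IH[of r] r that(1) by (auto simp del: comp_apply)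
        moreover have "g \<in> raising (k - r)" using less.IH[of "k - r"] r that(2)
          by (auto simp add: Suc_le_eq simp del: comp_apply)
        ultimately have "f \<circ> g \<in> raising (k - r + r)" by (rule raising_comp)
        then show ?thesis using r by simp
      qed
      then show "{f \<circ> g |f g. f \<in> mult_alg_power r \<and> g \<in> mult_alg_power (k - r)} \<subseteq> raising k" by blast
    qed
    then have "fn.span (\<Union>r\<in>{1..<k}. prod_space (fun_scale scale) (\<circ>) (mult_alg_power r) (mult_alg_power (k - r))) \<subseteq> raising k"
      by (intro fn.span_minimal raising_subspace) blast
    then show ?thesis using False less.prems by (subst alg_power.simps) simp
  qed
qed

lemma N_nilpotent_imp_mult_alg_nilpotent:
  assumes "nilpotent_algebra scale mult N"
  shows "nilpotent_algebra (fun_scale scale) (\<circ>) mult_alg"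
proof -
  obtain n where n: "1 \<le> n" "N_power n = {0}" using assms by (auto simp: nilpotent_algebra_def)
  have "f = 0" if "f \<in> mult_alg_power (Suc n)" for f
  proof -
    have f: "f \<in> raising (Suc n)" using that mult_alg_power_raising[of "Suc n"] by auto
    have "f x = 0" for x
    proof (cases "x \<in> N")
      case True
      then have "x \<in> N_power 1" by (simp add: alg_power_1)
      then have "f x \<in> N_power (1 + Suc n)" using f unfolding raising_def by blast
      also have "\<dots> \<subseteq> N_power n" using n by (intro N_power_antimono) auto
      finally show ?thesis using n by simp
    qed (use f in \<open>simp add: raising_def endo_def\<close>)
    then show ?thesis by auto
  qed
  moreover have "0 \<in> mult_alg_power (Suc n)"
    using n by (subst alg_power.simps) (simp add: fn.span_zero)
  ultimately have "mult_alg_power (Suc n) = {0}" by blast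
  then show ?thesis unfolding nilpotent_algebra_def by (intro exI[of _ "Suc n"]) simp
qed

text \<open>
  On \<open>N\<close> a word of left multiplications agrees with an element of the corresponding power of
  the multiplication algebra; the empty word is excluded since that algebra need not contain
  the identity.
\<close>
lemma act_as_mult_alg_power_element:
  assumes "set vs \<subseteq> V" "vs \<noteq> []"
  shows "\<exists>f \<in> mult_alg_power (length vs). \<forall>x \<in> N. f x = act vs x"
  using assms
proof (induction vs)
  case (Cons v vs)
  have L: "left_mult mult N v \<in> mult_alg"
    using Cons.prems by (auto simp: mult_algebra_def intro: hull_inc)
  show ?case
  proof (cases "vs = []")
    case True
    have "left_mult mult N v \<in> mult_alg_power (length (v # vs))" using L True by (simp add: alg_power_1)
    moreover have "\<forall>x \<in> N. left_mult mult N v x = act (v # vs) x"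
      using True by (simp add: left_mult_def)
    ultimately show ?thesis by blast
  next
    case False
    have "set vs \<subseteq> V" using Cons.prems by simp
    then obtain f where f: "f \<in> mult_alg_power (length vs)" "\<forall>x \<in> N. f x = act vs x"
      using Cons.IH[OF _ False] by blast
    let ?n = "Suc (length vs)"
    have "left_mult mult N v \<circ> f \<in> prod_space (fun_scale scale) (\<circ>) (mult_alg_power 1) (mult_alg_power (?n - 1))"
      unfolding prod_space_def using L f(1) by (intro fn.span_base) (auto simp: alg_power_1)
    moreover have "1 \<in> {1..<?n}" using False by (cases vs) auto
    ultimately have "left_mult mult N v \<circ> f
        \<in> fn.span (\<Union>r\<in>{1..<?n}. prod_space (fun_scale scale) (\<circ>) (mult_alg_power r) (mult_alg_power (?n - r)))"
      by (intro fn.span_base) blast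
    then have "left_mult mult N v \<circ> f \<in> mult_alg_power ?n"
      using False by (subst alg_power.simps) simp
    moreover have "(left_mult mult N v \<circ> f) x = act (v # vs) x" if "x \<in> N" for x
    proof -
      have "act vs x \<in> N" using that Cons.prems by (intro act_closed[of V N]) (auto intro: N_mult)
      then show ?thesis using f(2) that by (simp add: left_mult_def)
    qed
    moreover have "length (v # vs) = ?n" by simp
    ultimately show ?thesis by metis
  qed
qed simp

text \<open>
  From \<open>V I = I\<close> it follows that \<open>I\<close> lies in \<open>N\<close> and is spanned by the images of words of any
  given length \<open>n\<close>, which vanish when the \<open>n\<close>-th power of the multiplication algebra does.
\<close>
lemma mult_alg_nilpotent_imp_no_stable_subspace:
  assumes nil: "nilpotent_algebra (fun_scale scale) (\<circ>) mult_alg"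
    and I: "subspace I" "prod_space scale mult V I = I"
  shows "I = {0}"
proof -
  obtain n where n: "1 \<le> n" "mult_alg_power n = {0}" using nil by (auto simp: nilpotent_algebra_def)
  have "prod_space scale mult V I \<subseteq> N"
    by (intro prod_space_minimal subspace_N)
      (use V_subset_N N_mult mult_commute in \<open>metis\<close>)
  then have IN: "I \<subseteq> N" using I by simp
  have "I \<subseteq> span ({0} \<union> {v \<odot> g |v g. v \<in> V \<and> g \<in> I})"
    using I(2) span_mono[of "{v \<odot> g |v g. v \<in> V \<and> g \<in> I}"] unfolding prod_space_eq by blast
  then have "I \<subseteq> span ({0} \<union> {act vs g |vs g. set vs \<subseteq> V \<and> length vs = n \<and> g \<in> I})"
    by (rule subset_span_act) auto
  also have "\<dots> \<subseteq> {0}"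
  proof (rule span_minimal)
    have "act vs g = 0" if "set vs \<subseteq> V" "length vs = n" "g \<in> I" for vs g
    proof -
      have vs: "vs \<noteq> []" using that(2) n(1) by auto
      have "\<exists>f \<in> mult_alg_power n. \<forall>x \<in> N. f x = act vs x"
        using act_as_mult_alg_power_element[OF that(1) vs] unfolding that(2) .
      then obtain f where "f \<in> mult_alg_power n" "\<forall>x \<in> N. f x = act vs x" by blast
      moreover have "g \<in> N" using that(3) IN by blast
      ultimately show ?thesis using n(2) by fastforce
    qed
    then show "{0} \<union> {act vs g |vs g. set vs \<subseteq> V \<and> length vs = n \<and> g \<in> I} \<subseteq> {0}" by auto
  qed simp
  finally show ?thesis using subspace_0[OF I(1)] by blast
qed

lemma no_stable_subspace_imp_N_nilpotent:
  assumes art: "artinian_algebra scale mult"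
    and no: "\<And>I. subspace I \<Longrightarrow> prod_space scale mult V I = I \<Longrightarrow> I = {0}"
  shows "nilpotent_algebra scale mult N"
proof -
  obtain k where "principal_power (Suc k) = principal_power k" using artinian_stable_ideal[OF art] by blast
  then have "principal_power k = {0}" using stable_ideal_zero[OF art] no by blast
  then show ?thesis by (rule nilpotent_if_principal_power_zero)
qed

end

section \<open>The equivalence\<close>

lemma char_not_2_3:
  assumes "CHAR('k::field) \<noteq> 2" "CHAR('k) \<noteq> 3"
  shows "(2::'k) \<noteq> 0" "(3::'k) \<noteq> 0"
proof -
  have p: "(of_nat p :: 'k) \<noteq> 0" if "p = 2 \<or> p = 3" for p
  proof
    assume "(of_nat p :: 'k) = 0"
    then have "CHAR('k) dvd p" by (simp add: of_nat_eq_0_iff_char_dvd)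
    then have "CHAR('k) \<le> 3" "CHAR('k) \<noteq> 0"
      using that dvd_imp_le[of "CHAR('k)" p] by (auto intro!: Nat.gr0I)
    moreover have "CHAR('k) \<noteq> 1" by simp
    ultimately show False using assms by linarith
  qed
  show "(2::'k) \<noteq> 0" using p[of 2] by simp
  show "(3::'k) \<noteq> 0" using p[of 3] by simp
qed

theorem theorem5p2:
  fixes scale :: "'k::field \<Rightarrow> 'a::ab_group_add \<Rightarrow> 'a"
    and mult :: "'a \<Rightarrow> 'a \<Rightarrow> 'a"
    and \<omega> :: "'a \<Rightarrow> 'k"
    and e :: 'a
    and U V N :: "'a set"
  assumes "infinite (UNIV :: 'k set)"
    and "CHAR('k) \<noteq> 2" and "CHAR('k) \<noteq> 3"
    and "bernstein_algebra scale mult \<omega>"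
    and "artinian_algebra scale mult"
    and "e \<noteq> 0" and "mult e e = e"
    and "U = peirce_half scale mult e"
    and "V = peirce_zero mult e"
    and "N = barideal \<omega>"
  shows "(nilpotent_algebra scale mult N \<longleftrightarrow>
          nilpotent_algebra (fun_scale scale) (\<circ>) (mult_algebra scale mult N V)) \<and>
         (nilpotent_algebra scale mult N \<longleftrightarrow>
          (\<forall>I. module.subspace scale I \<and> prod_space scale mult V I = I \<longleftrightarrow> I = {0}))"
proof -
  interpret bernstein_idempotent scale mult \<omega> e
    using assms char_not_2_3[where 'k = 'k]
    by (auto simp: bernstein_idempotent_def bernstein_idempotent_axioms_def)
  have zero: "subspace {0}" "prod_space scale mult V {0} = {0}"
    using prod_space_minimal[of "{0}" V "{0}"] subspace_0[OF subspace_prod_space, of V "{0}"] by auto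
  show ?thesis
    unfolding assms(9,10)
    using N_nilpotent_imp_mult_alg_nilpotent mult_alg_nilpotent_imp_no_stable_subspace
      no_stable_subspace_imp_N_nilpotent[OF assms(5)] zero[unfolded assms(9)] by blast
qed

end
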